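(* Let $d\in\mathbb{N}$, $a>0$, and let $\kappa$ be a nonnegative multiplicity function on a root system in $\mathbb{R}^d$ with $2\lambda_\kappa+a>0$. If $\mathcal{F}_{\kappa,a}(\mathcal{S}(\mathbb{R}^d))=\mathcal{S}(\mathbb{R}^d)$, then $a=2$.
   Context: $\mathcal{S}(\mathbb{R}^d)$ is the Schwartz space. Functions in $L^2$ are identified with their continuous representatives when these exist. $\Omega\subset\mathbb{R}^d\setminus\{0\}$ is a root system, $\sigma_\alpha$ the reflection in the hyperplane orthogonal to $\alpha$, $G$ the finite group generated by the $\sigma_\alpha$, $\alpha\in\Omega$, and $\kappa:\Omega\to[0,\infty)$ is $G$-invariant. Put $\langle\kappa\rangle=\frac12\sum_{\alpha\in\Omega}\kappa(\alpha)$, $\lambda_\kappa=\langle\kappa\rangle+\frac{d-2}2$, $\lambda_{\kappa,a}=2\lambda_\kappa/a$ (for $d=1$, $\kappa$ is identified with the number $\langle\kappa\rangle$). Let $v_\kappa(x)=\prod_{\alpha\in\Omega}|\langle\alpha,x\rangle|^{\kappa(\alpha)}$, $v_{\kappa,a}(x)=|x|^{a-2}v_\kappa(x)$, $d\mu_{\kappa,a}(x)=c_{\kappa,a}v_{\kappa,a}(x)\,dx$ with $c_{\kappa,a}^{-1}=\int_{\mathbb{R}^d}e^{-|x|^a/a}v_{\kappa,a}(x)\,dx$. Dunkl operators: $T_\xi f(x)=\partial_\xi f(x)+\frac12\sum_{\alpha\in\Omega}\kappa(\alpha)\langle\alpha,\xi\rangle\frac{f(x)-f(\sigma_\alpha x)}{\langle\alpha,x\rangle}$;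 Dunkl Laplacian $\Delta_\kappa=\sum_{i=1}^dT_{e_i}^2$; $\Delta_{\kappa,a}=|x|^{2-a}\Delta_\kappa-|x|^a$. The $(\kappa,a)$-generalized Fourier transform is the unitary operator on $L^2(\mathbb{R}^d,d\mu_{\kappa,a})$ $$\mathcal{F}_{\kappa,a}=\exp\Bigl(\tfrac{i\pi}{2}(\lambda_{\kappa,a}+1)\Bigr)\exp\Bigl(\tfrac{i\pi}{2a}\Delta_{\kappa,a}\Bigr).$$ Equivalently, it is the unitary operator determined by $\mathcal{F}_{\kappa,a}\Phi=e^{-i\pi(\ell+n/a)}\Phi$ for all $\Phi(x)=p(x)L_\ell^{(2(\lambda_\kappa+n)/a)}\bigl(\tfrac2a|x|^a\bigr)e^{-|x|^a/a}$, where $\ell,n\in\mathbb{Z}_+$, $p$ is a homogeneous polynomial of degree $n$ with $\Delta_\kappa p=0$, and $L_\ell^{(\nu)}$ is the Laguerre polynomial; such $\Phi$ span a dense subspace. It is an integral transform $\mathcal{F}_{\kappa,a}(f)(y)=\int_{\mathbb{R}^d}B_{\kappa,a}(x,y)f(x)\,d\mu_{\kappa,a}(x)$ with a continuous symmetric kernel satisfying $B_{\kappa,a}(0,y)=1$. *)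

theory Defs
  imports "HOL-Analysis.Analysis"
begin

section \<open>Root systems and multiplicity functions\<close>

definition reflection :: "'a::euclidean_space \<Rightarrow> 'a \<Rightarrow> 'a" where
  "reflection \<alpha> x = x - (2 * (\<alpha> \<bullet> x) / (\<alpha> \<bullet> \<alpha>)) *\<^sub>R \<alpha>"

text \<open>
  A root system in the general sense of Dunkl theory: neither reducedness, nor crystallographic
  integrality, nor spanning of the whole space is required, and the empty system is allowed.
\<close>

definition root_system :: "'a::euclidean_space set \<Rightarrow> bool" where
  "root_system \<Omega> \<longleftrightarrow> finite \<Omega> \<and> 0 \<notin> \<Omega> \<and> (\<forall>\<alpha>\<in>\<Omega>. reflection \<alpha> ` \<Omega> = \<Omega>)"

text \<open>
  The reflections are involutions, so closing under composition with them yields the group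
  they generate.
\<close>

inductive_set reflection_group :: "'a::euclidean_space set \<Rightarrow> ('a \<Rightarrow> 'a) set"
  for \<Omega> :: "'a set" where
  id: "id \<in> reflection_group \<Omega>"
| step: "\<alpha> \<in> \<Omega> \<Longrightarrow> g \<in> reflection_group \<Omega> \<Longrightarrow> reflection \<alpha> \<circ> g \<in> reflection_group \<Omega>"

definition nonneg_multiplicity :: "'a::euclidean_space set \<Rightarrow> ('a \<Rightarrow> real) \<Rightarrow> bool" where
  "nonneg_multiplicity \<Omega> \<kappa> \<longleftrightarrow>
     (\<forall>\<alpha>\<in>\<Omega>. 0 \<le> \<kappa> \<alpha>) \<and> (\<forall>g\<in>reflection_group \<Omega>. \<forall>\<alpha>\<in>\<Omega>. \<kappa> (g \<alpha>) = \<kappa> \<alpha>)"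

definition mult_index :: "'a::euclidean_space set \<Rightarrow> ('a \<Rightarrow> real) \<Rightarrow> real" where
  "mult_index \<Omega> \<kappa> = (1/2) * (\<Sum>\<alpha>\<in>\<Omega>. \<kappa> \<alpha>)"

definition dunkl_lambda :: "'a::euclidean_space set \<Rightarrow> ('a \<Rightarrow> real) \<Rightarrow> real" where
  "dunkl_lambda \<Omega> \<kappa> = mult_index \<Omega> \<kappa> + (real DIM('a) - 2) / 2"


section \<open>The weighted measure\<close>

text \<open>
  The convention \<open>0 powr s = 0\<close> only affects the weights at the origin and on finitely many
  hyperplanes, a Lebesgue null set.
\<close>

definition dunkl_weight :: "'a::euclidean_space set \<Rightarrow> ('a \<Rightarrow> real) \<Rightarrow> 'a \<Rightarrow> real" where
  "dunkl_weight \<Omega> \<kappa> x = (\<Prod>\<alpha>\<in>\<Omega>. \<bar>\<alpha> \<bullet> x\<bar> powr \<kappa> \<alpha>)"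

definition gen_weight :: "'a::euclidean_space set \<Rightarrow> ('a \<Rightarrow> real) \<Rightarrow> real \<Rightarrow> 'a \<Rightarrow> real" where
  "gen_weight \<Omega> \<kappa> a x = norm x powr (a - 2) * dunkl_weight \<Omega> \<kappa> x"

definition gen_const :: "'a::euclidean_space set \<Rightarrow> ('a \<Rightarrow> real) \<Rightarrow> real \<Rightarrow> real" where
  "gen_const \<Omega> \<kappa> a =
     inverse (LINT x|lborel. exp (- (norm x powr a / a)) * gen_weight \<Omega> \<kappa> a x)"

definition gen_measure :: "'a::euclidean_space set \<Rightarrow> ('a \<Rightarrow> real) \<Rightarrow> real \<Rightarrow> 'a measure" where
  "gen_measure \<Omega> \<kappa> a =
     density lborel (\<lambda>x. ennreal (gen_const \<Omega> \<kappa> a * gen_weight \<Omega> \<kappa> a x))"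


section \<open>Dunkl operators and harmonic polynomials\<close>

definition dir_deriv :: "'a::euclidean_space \<Rightarrow> ('a \<Rightarrow> complex) \<Rightarrow> 'a \<Rightarrow> complex" where
  "dir_deriv \<xi> f x = frechet_derivative f (at x) \<xi>"

text \<open>
  On the hyperplane orthogonal to \<open>\<alpha>\<close> the quotient \<open>(f x - f (reflection \<alpha> x)) / (\<alpha> \<bullet> x)\<close> is
  read as its continuous extension: for \<open>C\<^sup>1\<close> functions the limit is the one below, because
  \<open>x - reflection \<alpha> x = (2 * (\<alpha> \<bullet> x) / (\<alpha> \<bullet> \<alpha>)) *\<^sub>R \<alpha>\<close>.
\<close>

definition reflection_quotient :: "'a::euclidean_space \<Rightarrow> ('a \<Rightarrow> complex) \<Rightarrow> 'a \<Rightarrow> complex" where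
  "reflection_quotient \<alpha> f x =
     (if \<alpha> \<bullet> x = 0 then (2 / (\<alpha> \<bullet> \<alpha>)) *\<^sub>R dir_deriv \<alpha> f x
      else (f x - f (reflection \<alpha> x)) /\<^sub>R (\<alpha> \<bullet> x))"

definition dunkl_op ::
  "'a::euclidean_space set \<Rightarrow> ('a \<Rightarrow> real) \<Rightarrow> 'a \<Rightarrow> ('a \<Rightarrow> complex) \<Rightarrow> 'a \<Rightarrow> complex" where
  "dunkl_op \<Omega> \<kappa> \<xi> f x =
     dir_deriv \<xi> f x
     + (1/2) * (\<Sum>\<alpha>\<in>\<Omega>. (\<kappa> \<alpha> * (\<alpha> \<bullet> \<xi>)) *\<^sub>R reflection_quotient \<alpha> f x)"

definition dunkl_laplacian ::
  "'a::euclidean_space set \<Rightarrow> ('a \<Rightarrow> real) \<Rightarrow> ('a \<Rightarrow> complex) \<Rightarrow> 'a \<Rightarrow> complex" where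
  "dunkl_laplacian \<Omega> \<kappa> f x = (\<Sum>e\<in>Basis. dunkl_op \<Omega> \<kappa> e (dunkl_op \<Omega> \<kappa> e f) x)"

definition homogeneous_polynomial :: "nat \<Rightarrow> ('a::euclidean_space \<Rightarrow> complex) \<Rightarrow> bool" where
  "homogeneous_polynomial n p \<longleftrightarrow>
     polynomial_function p \<and> (\<forall>t x. p (t *\<^sub>R x) = (t ^ n) *\<^sub>R p x)"

definition dunkl_harmonic ::
  "'a::euclidean_space set \<Rightarrow> ('a \<Rightarrow> real) \<Rightarrow> nat \<Rightarrow> ('a \<Rightarrow> complex) \<Rightarrow> bool" where
  "dunkl_harmonic \<Omega> \<kappa> n p \<longleftrightarrow>
     homogeneous_polynomial n p \<and> (\<forall>x. dunkl_laplacian \<Omega> \<kappa> p x = 0)"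


section \<open>The generalized Fourier transform\<close>

definition laguerre :: "nat \<Rightarrow> real \<Rightarrow> real \<Rightarrow> real" where
  "laguerre l \<nu> t = (\<Sum>k\<le>l. (- 1) ^ k * ((\<nu> + real l) gchoose (l - k)) * t ^ k / fact k)"

definition laguerre_harmonic ::
  "'a::euclidean_space set \<Rightarrow> ('a \<Rightarrow> real) \<Rightarrow> real \<Rightarrow> nat \<Rightarrow> nat \<Rightarrow> ('a \<Rightarrow> complex) \<Rightarrow> 'a \<Rightarrow> complex"
  where
  "laguerre_harmonic \<Omega> \<kappa> a l n p x =
     p x * of_real (laguerre l (2 * (dunkl_lambda \<Omega> \<kappa> + real n) / a) (2 / a * norm x powr a)
                    * exp (- (norm x powr a / a)))"

text \<open>
  Square-integrable functions are handled through representatives; \<open>L2_class M f\<close> is the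
  almost-everywhere class of \<open>f\<close>, i.e. the actual element of the Hilbert space.
\<close>

definition L2 :: "'a measure \<Rightarrow> ('a \<Rightarrow> complex) set" where
  "L2 M = {f \<in> borel_measurable M. integrable M (\<lambda>x. (cmod (f x))\<^sup>2)}"

definition L2_class :: "'a measure \<Rightarrow> ('a \<Rightarrow> complex) \<Rightarrow> ('a \<Rightarrow> complex) set" where
  "L2_class M f = {g \<in> L2 M. AE x in M. g x = f x}"

definition L2_inner :: "'a measure \<Rightarrow> ('a \<Rightarrow> complex) \<Rightarrow> ('a \<Rightarrow> complex) \<Rightarrow> complex" where
  "L2_inner M f g = (LINT x|M. f x * cnj (g x))"

definition unitary_L2 :: "'a measure \<Rightarrow> (('a \<Rightarrow> complex) \<Rightarrow> ('a \<Rightarrow> complex)) \<Rightarrow> bool" where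
  "unitary_L2 M U \<longleftrightarrow>
     (\<forall>f\<in>L2 M. U f \<in> L2 M) \<and>
     (\<forall>f\<in>L2 M. \<forall>g\<in>L2 M. (AE x in M. f x = g x) \<longrightarrow> (AE x in M. U f x = U g x)) \<and>
     (\<forall>f\<in>L2 M. \<forall>g\<in>L2 M. AE x in M. U (\<lambda>y. f y + g y) x = U f x + U g x) \<and>
     (\<forall>c. \<forall>f\<in>L2 M. AE x in M. U (\<lambda>y. c * f y) x = c * U f x) \<and>
     (\<forall>f\<in>L2 M. \<forall>g\<in>L2 M. L2_inner M (U f) (U g) = L2_inner M f g) \<and>
     (\<forall>g\<in>L2 M. \<exists>f\<in>L2 M. AE x in M. U f x = g x)"

text \<open>
  The functions \<open>\<Phi> = laguerre_harmonic \<Omega> \<kappa> a l n p\<close> are eigenfunctions of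
  \<open>\<Delta>\<^bsub>\<kappa>,a\<^esub>\<close>, with eigenvalue \<open>- a * (2 * l + \<lambda>\<^bsub>\<kappa>,a\<^esub> + 1) - 2 * n\<close>, and their span is dense in \<open>L2\<close>.
  Hence \<open>exp (\<i> * \<pi> / 2 * (\<lambda>\<^bsub>\<kappa>,a\<^esub> + 1)) * exp (\<i> * \<pi> / (2 * a) * \<Delta>\<^bsub>\<kappa>,a\<^esub>)\<close> multiplies \<open>\<Phi>\<close> by
  \<open>exp (- \<i> * \<pi> * (l + n / a))\<close>, and this determines the unitary operator up to equality
  almost everywhere.
\<close>

definition gen_fourier_transform ::
  "'a::euclidean_space set \<Rightarrow> ('a \<Rightarrow> real) \<Rightarrow> real \<Rightarrow> (('a \<Rightarrow> complex) \<Rightarrow> ('a \<Rightarrow> complex)) \<Rightarrow> bool"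
  where
  "gen_fourier_transform \<Omega> \<kappa> a F \<longleftrightarrow>
     unitary_L2 (gen_measure \<Omega> \<kappa> a) F \<and>
     (\<forall>l n p. dunkl_harmonic \<Omega> \<kappa> n p \<longrightarrow>
        (AE x in gen_measure \<Omega> \<kappa> a.
           F (laguerre_harmonic \<Omega> \<kappa> a l n p) x
           = exp (- (\<i> * of_real (pi * (real l + real n / a)))) * laguerre_harmonic \<Omega> \<kappa> a l n p x))"


section \<open>The Schwartz space\<close>

text \<open>
  Requiring every iterated partial derivative to be Frechet differentiable everywhere is
  equivalent to being \<open>C\<^sup>\<infinity>\<close>: the differentiable partial derivatives of each order are in
  particular continuous.
\<close>

definition iter_deriv :: "'a::euclidean_space list \<Rightarrow> ('a \<Rightarrow> complex) \<Rightarrow> 'a \<Rightarrow> complex" where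
  "iter_deriv es f = foldr dir_deriv es f"

definition schwartz :: "('a::euclidean_space \<Rightarrow> complex) set" where
  "schwartz = {f. \<forall>es\<in>lists Basis.
     (\<forall>x. iter_deriv es f differentiable (at x)) \<and>
     (\<forall>k::nat. bounded (range (\<lambda>x. (norm x ^ k) *\<^sub>R iter_deriv es f x)))}"

end

theory Submission
  imports Defs "HOL-Complex_Analysis.Complex_Analysis"
begin

text \<open>
  Put \<open>s x = norm x powr a / a\<close> and \<open>\<nu> = 2 * \<lambda> / a\<close>. The radial eigenfunctions (\<open>n = 0\<close>) and the generating
  function of the Laguerre polynomials show that \<open>exp (- t * s)\<close> is mapped to
  \<open>t powr (- (\<nu> + 1)) * exp (- s / t)\<close>. Pairing with a Schwartz function \<open>f\<close> whose transform \<open>g\<close> is a Schwartz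
  function and using the homogeneity of the measure \<open>\<mu>\<close>, one gets, for \<open>0 < u \<le> 1\<close>,
  \<open>\<integral> g x * exp (- u * s x) d\<mu> = \<integral> f (u powr (1 / a) *\<^sub>R x) * exp (- s x) d\<mu>\<close>.
  As \<open>u\<close> tends to \<open>0\<close>, the left side differs from its limit by \<open>O(u)\<close> since \<open>g\<close> decays rapidly, and the right side by
  \<open>O(u powr (2 / a))\<close> since \<open>f\<close> is smooth and \<open>\<mu>\<close> is even. For a Gaussian \<open>g\<close>, respectively \<open>f\<close>, these orders are
  attained. Hence \<open>f\<close> Gaussian rules out \<open>2 / a < 1\<close>, and \<open>g\<close> Gaussian rules out \<open>2 / a > 1\<close>.
\<close>

section \<open>Rapidly decreasing functions\<close>

text \<open>With \<open>d\<close> the dimension, the integrand on the \<open>n\<close>-th shell is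
  \<open>O((b ^ n) powr p)\<close> and the volume is \<open>O(b ^ (n * d))\<close>, so the integral
  is dominated by a geometric series of ratio \<open>b powr (p + d)\<close>.\<close>

lemma integrable_powr_on_shells:
  fixes b m M p :: real
  assumes b: "b > 0" and m: "0 < m" "m \<le> M" and small: "b powr (p + real DIM('a::euclidean_space)) < 1"
  shows "integrable lborel (\<lambda>x::'a.
           indicator (\<Union>n. {x. b ^ n * m \<le> norm x \<and> norm x \<le> b ^ n * M}) x * norm x powr p)"
proof -
  define d where "d = DIM('a)"
  define A where "A = (\<lambda>n. {x::'a. b ^ n * m \<le> norm x \<and> norm x \<le> b ^ n * M})"
  \<comment> \<open>The maximum serves both signs of \<open>p\<close>: \<open>y powr p\<close> is
    increasing or decreasing on the interval from \<open>m\<close> to \<open>M\<close>, so it is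
    largest at an endpoint.\<close>
  define K where "K = max (m powr p) (M powr p)"
  define V where "V = unit_ball_vol (real d)"
  define \<theta> where "\<theta> = b powr (p + real d)"
  have [measurable]: "A n \<in> sets borel" for n unfolding A_def by measurable
  have K: "K \<ge> 0" by (simp add: K_def le_max_iff_disj)
  have V: "V \<ge> 0" by (simp add: V_def)
  have \<theta>: "0 \<le> \<theta>" "\<theta> < 1" using small by (auto simp: \<theta>_def d_def)
  have bound: "norm x powr p \<le> K * (b ^ n) powr p" if "x \<in> A n" for x n
  proof -
    define y where "y = norm x / b ^ n"
    have y: "m \<le> y" "y \<le> M" "norm x = y * b ^ n"
      using that b by (auto simp: y_def A_def field_simps)
    have "y powr p \<le> K"
    proof (cases "p \<ge> 0")
      case True then show ?thesis
        using powr_mono2[of p y M] y m by (auto simp: K_def)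
    next
      case False then show ?thesis
        using powr_mono2'[of p m y] y m by (auto simp: K_def)
    qed
    then show ?thesis using y b m by (simp add: powr_mult mult_right_mono)
  qed
  have vol: "emeasure lborel (A n) \<le> ennreal (V * (b ^ n * M) ^ d)" for n
  proof -
    have "emeasure lborel (A n) \<le> emeasure lborel (cball (0::'a) (b ^ n * M))"
      by (rule emeasure_mono) (auto simp: A_def)
    also have "\<dots> = ennreal (V * (b ^ n * M) ^ d)"
      using b m by (subst emeasure_cball) (auto simp: V_def d_def)
    finally show ?thesis .
  qed
  have term_eq: "K * (b ^ n) powr p * (V * (b ^ n * M) ^ d) = K * V * M ^ d * \<theta> ^ n" for n
  proof -
    have "(b ^ n) powr p * (b ^ n) ^ d = \<theta> ^ n"
    proof -
      have "(b ^ n) powr p * (b ^ n) ^ d = (b ^ n) powr (p + real d)"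
        using b by (simp add: powr_add powr_realpow)
      also have "\<dots> = \<theta> ^ n"
        using b by (simp add: \<theta>_def powr_powr powr_realpow[symmetric] powr_power mult.commute)
      finally show ?thesis .
    qed
    then show ?thesis by (simp add: power_mult_distrib mult_ac)
  qed
  have "(\<integral>\<^sup>+x. ennreal (norm (indicator (\<Union>n. A n) x * norm x powr p)) \<partial>lborel)
      \<le> (\<integral>\<^sup>+x. (\<Sum>n. ennreal (K * (b ^ n) powr p) * indicator (A n) x) \<partial>lborel)"
  proof (rule nn_integral_mono)
    fix x :: 'a
    show "ennreal (norm (indicator (\<Union>n. A n) x * norm x powr p))
        \<le> (\<Sum>n. ennreal (K * (b ^ n) powr p) * indicator (A n) x)"
    proof (cases "x \<in> (\<Union>n. A n)")
      case True
      then obtain n where n: "x \<in> A n" by auto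
      have "ennreal (norm (indicator (\<Union>n. A n) x * norm x powr p)) \<le> ennreal (K * (b ^ n) powr p)"
        using bound[OF n] True by (intro ennreal_leI) auto
      \<comment> \<open>The shells may overlap; keeping the term of one shell that contains
        \<open>x\<close> is enough for an upper bound.\<close>
      also have "\<dots> = (\<Sum>k\<in>{n}. ennreal (K * (b ^ k) powr p) * indicator (A k) x)"
        using n by simp
      also have "\<dots> \<le> (\<Sum>n. ennreal (K * (b ^ n) powr p) * indicator (A n) x)"
        by (rule sum_le_suminf) auto
      finally show ?thesis .
    qed auto
  qed
  also have "\<dots> = (\<Sum>n. ennreal (K * (b ^ n) powr p) * emeasure lborel (A n))"
    by (subst nn_integral_suminf) (auto simp: nn_integral_cmult_indicator)
  also have "\<dots> \<le> (\<Sum>n. ennreal (K * (b ^ n) powr p) * ennreal (V * (b ^ n * M) ^ d))"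
    by (intro suminf_le mult_left_mono vol) auto
  also have "\<dots> = (\<Sum>n. ennreal (K * V * M ^ d * \<theta> ^ n))"
    using K V b m by (intro suminf_cong) (simp flip: ennreal_mult term_eq)
  also have "\<dots> < \<infinity>"
    unfolding infinity_ennreal_def less_top[symmetric]
    using K V m \<theta> by (intro ennreal_suminf_neq_top summable_mult summable_geometric) auto
  finally have fin: "(\<integral>\<^sup>+x. ennreal (norm (indicator (\<Union>n. A n) x * norm x powr p)) \<partial>lborel) < \<infinity>" .
  have "integrable lborel (\<lambda>x. indicator (\<Union>n. A n) x * norm x powr p)"
    by (rule integrableI_bounded[OF _ fin]) measurable
  then show ?thesis by (simp add: A_def)
qed

lemma ex_power2_interval:
  assumes "(y::real) \<ge> 1"
  shows "\<exists>n. 2 ^ n \<le> y \<and> y \<le> 2 ^ Suc n"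
proof -
  define n where "n = nat \<lfloor>log 2 y\<rfloor>"
  have "0 \<le> log 2 y" using assms by simp
  then have "real n \<le> log 2 y" "log 2 y \<le> real (Suc n)"
    by (auto simp: n_def) linarith
  then have "2 powr (real n) \<le> y" "y \<le> 2 powr (real (Suc n))"
    using assms by (auto simp: powr_le_iff le_powr_iff)
  then show ?thesis by (subst (asm) (1 2) powr_realpow) auto
qed

text \<open>Shells with \<open>b = 1/2\<close> exhaust the punctured unit ball, and the sign of
  \<open>p + DIM('a)\<close> makes the ratio smaller than 1. At the origin
  \<open>0 powr p = 0\<close>.\<close>

lemma integrable_norm_powr_inside:
  assumes p: "p + real DIM('a::euclidean_space) > 0"
  shows "integrable lborel (\<lambda>x::'a. indicator {x. norm x \<le> 1} x * norm x powr p)"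
proof -
  have "integrable lborel (\<lambda>x::'a. indicator (\<Union>n. {x. (1/2) ^ n * (1/2) \<le> norm x \<and> norm x \<le> (1/2) ^ n * 1}) x * norm x powr p)"
    using p by (intro integrable_powr_on_shells) (auto simp: powr01_less_one)
  then show ?thesis
  proof (rule Bochner_Integration.integrable_bound, goal_cases)
    case 2
    have "x \<in> (\<Union>n. {x. (1/2) ^ n * (1/2) \<le> norm x \<and> norm x \<le> (1/2) ^ n * 1})"
      if x: "x \<noteq> 0" "norm x \<le> 1" for x :: 'a
    proof -
      obtain n where "2 ^ n \<le> 1 / norm x" "1 / norm x \<le> 2 ^ Suc n"
        using ex_power2_interval[of "1 / norm x"] x by auto
      then have "(1/2) ^ n * (1/2) \<le> norm x \<and> norm x \<le> (1/2) ^ n * 1"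
        using x by (simp add: field_simps power_one_over)
      then show ?thesis by blast
    qed
    then show ?case by (intro AE_I2) (auto simp: indicator_def)
  qed measurable
qed

text \<open>Shells with \<open>b = 2\<close> exhaust the exterior of the unit ball; now the opposite
  sign of \<open>p + DIM('a)\<close> makes the ratio smaller than 1.\<close>

lemma integrable_norm_powr_outside:
  assumes p: "p + real DIM('a::euclidean_space) < 0"
  shows "integrable lborel (\<lambda>x::'a. indicator {x. norm x \<ge> 1} x * norm x powr p)"
proof -
  have "integrable lborel (\<lambda>x::'a. indicator (\<Union>n. {x. 2 ^ n * 1 \<le> norm x \<and> norm x \<le> 2 ^ n * 2}) x * norm x powr p)"
    using p by (intro integrable_powr_on_shells) (auto simp: powr_less_one)
  then show ?thesis
  proof (rule Bochner_Integration.integrable_bound, goal_cases)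
    case 2
    have "x \<in> (\<Union>n. {x. 2 ^ n * 1 \<le> norm x \<and> norm x \<le> 2 ^ n * 2})"
      if x: "norm x \<ge> 1" for x :: 'a
      using ex_power2_interval[OF x] by (auto simp: mult.commute)
    then show ?case by (intro AE_I2) (auto simp: indicator_def)
  qed measurable
qed

text \<open>Only decay is asked, no smoothness, so that functions such as
  \<open>exp (- (c * norm x powr q))\<close>, which need not be smooth at the origin, are
  included.\<close>

definition rapidly_decreasing :: "('a::real_normed_vector \<Rightarrow> 'b::real_normed_vector) \<Rightarrow> bool" where
  "rapidly_decreasing h \<longleftrightarrow> (\<forall>k::nat. \<exists>C. \<forall>x. norm x ^ k * norm (h x) \<le> C)"

text \<open>Inside the unit ball \<open>h\<close> is bounded and \<open>norm x powr p\<close> is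
  integrable; outside, decay of order \<open>N > p + DIM('a)\<close> lowers the exponent to the
  integrable \<open>p - N\<close>.\<close>

lemma integrable_norm_powr_rapidly_decreasing:
  fixes h :: "'a::euclidean_space \<Rightarrow> 'b::{banach, second_countable_topology}"
  assumes [measurable]: "h \<in> borel_measurable borel" and h: "rapidly_decreasing h"
    and p: "p + real DIM('a) > 0"
  shows "integrable lborel (\<lambda>x. norm x powr p *\<^sub>R h x)"
proof -
  obtain C where C: "norm (h x) \<le> C" for x
    using h[unfolded rapidly_decreasing_def, rule_format, of 0] by auto
  obtain N where N: "real N > p + real DIM('a)" using reals_Archimedean2 by blast
  obtain D where D: "norm x ^ N * norm (h x) \<le> D" for x
    using h[unfolded rapidly_decreasing_def, rule_format, of N] by auto
  have C0: "C \<ge> 0" using C[of 0] norm_ge_zero order_trans by blast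
  have D0: "D \<ge> 0" using D[of 0] by (smt (verit) mult_nonneg_nonneg norm_ge_zero zero_le_power)
  have "integrable lborel (\<lambda>x::'a. C * (indicator {x. norm x \<le> 1} x * norm x powr p)
      + D * (indicator {x. norm x \<ge> 1} x * norm x powr (p - real N)))"
    using p N by (intro Bochner_Integration.integrable_add integrable_mult_right
        integrable_norm_powr_inside integrable_norm_powr_outside) auto
  then show ?thesis
  proof (rule Bochner_Integration.integrable_bound, goal_cases)
    case 2
    have "norm (norm x powr p *\<^sub>R h x) \<le> C * (indicator {x. norm x \<le> 1} x * norm x powr p)
      + D * (indicator {x. norm x \<ge> 1} x * norm x powr (p - real N))" for x :: 'a
    proof (cases "norm x \<le> 1")
      case True
      have "norm x powr p * norm (h x) \<le> norm x powr p * C"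
        by (intro mult_left_mono C) auto
      moreover have "0 \<le> D * (indicator {x. norm x \<ge> 1} x * norm x powr (p - real N))"
        using D0 by auto
      ultimately show ?thesis using True by (simp add: mult_ac)
    next
      case False
      then have "norm x powr p * norm (h x) = norm x powr (p - real N) * (norm x ^ N * norm (h x))"
        using powr_realpow[of "norm x" N] by (cases "x = 0") (simp_all add: powr_diff)
      also have "\<dots> \<le> norm x powr (p - real N) * D"
        by (intro mult_left_mono D) auto
      finally show ?thesis using False by (simp add: mult_ac)
    qed
    then show ?case by (intro AE_I2) (smt (verit) real_norm_def)
  qed measurable
qed

section \<open>Closure properties and examples of rapid decrease\<close>

lemma rapidly_decreasing_le:
  assumes "rapidly_decreasing h" "\<And>x. norm (k x) \<le> norm (h x)"
  shows "rapidly_decreasing k"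
  unfolding rapidly_decreasing_def
proof
  fix n
  obtain C where C: "\<And>x. norm x ^ n * norm (h x) \<le> C"
    using assms(1) unfolding rapidly_decreasing_def by blast
  have "norm x ^ n * norm (k x) \<le> C" for x
    using C[of x] mult_left_mono[OF assms(2)[of x], of "norm x ^ n"] by simp
  then show "\<exists>C. \<forall>x. norm x ^ n * norm (k x) \<le> C" by blast
qed

lemma rapidly_decreasing_add:
  assumes "rapidly_decreasing h" "rapidly_decreasing k"
  shows "rapidly_decreasing (\<lambda>x. h x + k x)"
  unfolding rapidly_decreasing_def
proof
  fix n
  obtain C D where C: "\<And>x. norm x ^ n * norm (h x) \<le> C" and D: "\<And>x. norm x ^ n * norm (k x) \<le> D"
    using assms unfolding rapidly_decreasing_def by meson
  have "norm x ^ n * norm (h x + k x) \<le> C + D" for x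
  proof -
    have "norm x ^ n * norm (h x + k x) \<le> norm x ^ n * (norm (h x) + norm (k x))"
      by (intro mult_left_mono norm_triangle_ineq) auto
    then show ?thesis using C[of x] D[of x] by (simp add: distrib_left)
  qed
  then show "\<exists>C. \<forall>x. norm x ^ n * norm (h x + k x) \<le> C" by blast
qed

lemma rapidly_decreasing_power:
  assumes "rapidly_decreasing h"
  shows "rapidly_decreasing (\<lambda>x. norm x ^ n *\<^sub>R h x)"
  unfolding rapidly_decreasing_def
proof
  fix k
  obtain C where C: "\<And>x. norm x ^ (k + n) * norm (h x) \<le> C"
    using assms unfolding rapidly_decreasing_def by blast
  then show "\<exists>C. \<forall>x. norm x ^ k * norm (norm x ^ n *\<^sub>R h x) \<le> C"
    by (intro exI[of _ C]) (simp add: power_add mult_ac)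
qed

text \<open>A real exponent reduces to an integer one through
  \<open>norm x powr q \<le> 1 + norm x ^ n\<close> for \<open>n \<ge> q\<close>.\<close>

lemma rapidly_decreasing_powr:
  fixes h :: "'a::real_normed_vector \<Rightarrow> 'b::real_normed_vector"
  assumes "rapidly_decreasing h" "q \<ge> 0"
  shows "rapidly_decreasing (\<lambda>x. norm x powr q *\<^sub>R h x)"
proof -
  obtain n where n: "q \<le> real n" using real_arch_simple by blast
  have "rapidly_decreasing (\<lambda>x. norm (h x) + norm x ^ n *\<^sub>R norm (h x))"
    using assms by (intro rapidly_decreasing_add rapidly_decreasing_power)
      (auto simp: rapidly_decreasing_def)
  then show ?thesis
  proof (rule rapidly_decreasing_le)
    fix x :: 'a
    have "norm x powr q \<le> 1 + norm x ^ n"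
    proof (cases "norm x \<le> 1")
      case True then have "norm x powr q \<le> 1"
        using assms(2) by (simp add: powr_le1)
      then show ?thesis by (smt (verit) norm_ge_zero zero_le_power)
    next
      case False
      then have "norm x powr q \<le> norm x powr real n" using n by (intro powr_mono) auto
      then show ?thesis using False by (subst (asm) powr_realpow) auto
    qed
    then have "norm x powr q * norm (h x) \<le> (1 + norm x ^ n) * norm (h x)"
      by (intro mult_right_mono) auto
    then show "norm (norm x powr q *\<^sub>R h x) \<le> norm (norm (h x) + norm x ^ n *\<^sub>R norm (h x))"
      by (simp add: distrib_right)
  qed
qed

lemma rapidly_decreasing_bounded_mult:
  fixes h :: "'a::real_normed_vector \<Rightarrow> 'b::real_normed_vector"
    and k :: "'a \<Rightarrow> 'c::real_normed_vector"
  assumes "rapidly_decreasing h" "\<And>x. norm (k x) \<le> B * norm (h x)"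
  shows "rapidly_decreasing k"
proof -
  have "rapidly_decreasing (\<lambda>x. B *\<^sub>R h x)"
    unfolding rapidly_decreasing_def
  proof
    fix n
    obtain C where C: "\<And>x. norm x ^ n * norm (h x) \<le> C"
      using assms(1) unfolding rapidly_decreasing_def by blast
    have "norm x ^ n * norm (B *\<^sub>R h x) \<le> \<bar>B\<bar> * C" for x
      using mult_left_mono[OF C[of x], of "\<bar>B\<bar>"] by (simp add: mult_ac)
    then show "\<exists>C. \<forall>x. norm x ^ n * norm (B *\<^sub>R h x) \<le> C" by blast
  qed
  then show ?thesis
  proof (rule rapidly_decreasing_le)
    fix x show "norm (k x) \<le> norm (B *\<^sub>R h x)"
      using assms(2)[of x] by simp (meson abs_ge_self mult_right_mono norm_ge_zero order_trans)
  qed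
qed

text \<open>A single term of the exponential series, \<open>s ^ n / fact n \<le> exp s\<close>,
  dominates \<open>norm x ^ k\<close> away from the unit ball once
  \<open>q * n \<ge> k\<close>.\<close>

lemma rapidly_decreasing_exp_powr:
  assumes "c > 0" "q > 0"
  shows "rapidly_decreasing (\<lambda>x::'a::real_normed_vector. exp (- (c * norm x powr q)))"
  unfolding rapidly_decreasing_def
proof
  fix k :: nat
  obtain n where n: "real k \<le> q * real n"
    using assms(2) by (metis pos_divide_le_eq real_arch_simple mult.commute)
  have "norm x ^ k * norm (exp (- (c * norm x powr q))) \<le> 1 + fact n / c ^ n" for x :: 'a
  proof (cases "norm x \<le> 1")
    case True
    have "norm x ^ k * exp (- (c * norm x powr q)) \<le> 1 * 1"
      using True assms by (intro mult_mono power_le_one) auto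
    then show ?thesis using assms by (simp add: add_increasing2)
  next
    case False
    define s where "s = c * norm x powr q"
    have s: "s \<ge> 0" using assms by (simp add: s_def)
    have "s ^ n / fact n \<le> exp s"
      using sum_le_suminf[OF summable_exp, of "{n}" s] s
      by (auto simp: exp_def divide_inverse mult_ac)
    have "norm x ^ k = norm x powr real k" using False by (subst powr_realpow) auto
    also have "\<dots> \<le> norm x powr (q * real n)" using False n by (intro powr_mono) auto
    also have "\<dots> = (s / c) ^ n"
      using False assms powr_realpow[of "norm x powr q" n]
      by (cases "x = 0") (simp_all add: s_def powr_powr[symmetric])
    also have "\<dots> \<le> fact n / c ^ n * exp s"
      using \<open>s ^ n / fact n \<le> exp s\<close> assms by (simp add: power_divide field_simps)
    finally have "norm x ^ k * exp (- s) \<le> fact n / c ^ n"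
      by (simp add: exp_minus field_simps)
    then show ?thesis by (simp add: s_def)
  qed
  then show "\<exists>C. \<forall>x::'a. norm x ^ k * norm (exp (- (c * norm x powr q))) \<le> C" by blast
qed

lemma rapidly_decreasing_mult_bounded:
  fixes f :: "'a::real_normed_vector \<Rightarrow> 'b::real_normed_algebra"
  assumes "rapidly_decreasing f" "\<And>x. norm (k x) \<le> B"
  shows "rapidly_decreasing (\<lambda>x. f x * k x)" "rapidly_decreasing (\<lambda>x. k x * f x)"
proof -
  have "norm (f x * k x) \<le> B * norm (f x)" "norm (k x * f x) \<le> B * norm (f x)" for x
    using norm_mult_ineq[of "f x" "k x"] norm_mult_ineq[of "k x" "f x"]
      mult_right_mono[OF assms(2)[of x], of "norm (f x)"] by (auto simp: mult.commute)
  then show "rapidly_decreasing (\<lambda>x. f x * k x)" "rapidly_decreasing (\<lambda>x. k x * f x)"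
    by (auto intro!: rapidly_decreasing_bounded_mult[OF assms(1), of _ B])
qed

lemma rapidly_decreasing_imp_bounded:
  assumes "rapidly_decreasing h"
  obtains C where "C \<ge> 0" "\<And>x. norm (h x) \<le> C"
proof -
  obtain C where "\<And>x. norm x ^ 0 * norm (h x) \<le> C"
    using assms unfolding rapidly_decreasing_def by blast
  then have "norm (h x) \<le> C" for x by simp
  then show ?thesis using that norm_ge_zero order_trans by blast
qed

section \<open>Schwartz functions\<close>

lemma schwartz_differentiable: "f \<in> schwartz \<Longrightarrow> set es \<subseteq> Basis \<Longrightarrow> iter_deriv es f differentiable (at x)"
  by (auto simp: schwartz_def)

lemma schwartz_iter_deriv_rapidly_decreasing:
  assumes "f \<in> schwartz" "set es \<subseteq> Basis"
  shows "rapidly_decreasing (iter_deriv es f)"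
  unfolding rapidly_decreasing_def
proof
  fix k
  have "bounded (range (\<lambda>x. (norm x ^ k) *\<^sub>R iter_deriv es f x))"
    using assms by (auto simp: schwartz_def)
  then show "\<exists>C. \<forall>x. norm x ^ k * norm (iter_deriv es f x) \<le> C"
    by (auto simp: bounded_iff)
qed

lemma schwartz_rapidly_decreasing: "f \<in> schwartz \<Longrightarrow> rapidly_decreasing f"
  using schwartz_iter_deriv_rapidly_decreasing[of f "[]"] by (simp add: iter_deriv_def)

lemma schwartz_borel_measurable:
  assumes "f \<in> schwartz"
  shows "f \<in> borel_measurable borel"
proof -
  have "f differentiable (at x)" for x
    using schwartz_differentiable[OF assms, of "[]"] by (simp add: iter_deriv_def)
  then have "continuous_on UNIV f"
    by (intro continuous_at_imp_continuous_on ballI differentiable_imp_continuous_within)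
  then show ?thesis by (rule borel_measurable_continuous_onI)
qed

section \<open>Second-order estimate at the origin\<close>

lemma frechet_derivative_eq_sum_dir_deriv:
  assumes "f differentiable (at x)"
  shows "frechet_derivative f (at x) w = (\<Sum>i\<in>Basis. (w \<bullet> i) *\<^sub>R dir_deriv i f x)"
proof -
  have "linear (frechet_derivative f (at x))" using assms by (rule linear_frechet_derivative)
  then have "frechet_derivative f (at x) (\<Sum>i\<in>Basis. (w \<bullet> i) *\<^sub>R i) = (\<Sum>i\<in>Basis. (w \<bullet> i) *\<^sub>R dir_deriv i f x)"
    by (simp add: linear_sum linear_scale dir_deriv_def)
  then show ?thesis by (simp add: euclidean_representation)
qed

text \<open>Every coordinate of \<open>w\<close> is at most \<open>norm w\<close>, so the sum of the
  bounds on the partial derivatives bounds the operator norm of the derivative; the mean value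
  inequality does the rest.\<close>

lemma bounded_partials_imp_lipschitz:
  fixes g :: "'a::euclidean_space \<Rightarrow> complex"
  assumes diff: "\<And>x. g differentiable (at x)"
    and bound: "\<And>i x. i \<in> Basis \<Longrightarrow> norm (dir_deriv i g x) \<le> B i"
  shows "norm (g x - g y) \<le> (\<Sum>i\<in>Basis. B i) * norm (x - y)"
proof (rule differentiable_bound[of UNIV g "\<lambda>x. frechet_derivative g (at x)"])
  fix x
  show "(g has_derivative frechet_derivative g (at x)) (at x)"
    using diff frechet_derivative_works by blast
  have "norm (frechet_derivative g (at x) w) \<le> (\<Sum>i\<in>Basis. B i) * norm w" for w
  proof -
    have "norm (frechet_derivative g (at x) w) \<le> (\<Sum>i\<in>Basis. norm ((w \<bullet> i) *\<^sub>R dir_deriv i g x))"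
      unfolding frechet_derivative_eq_sum_dir_deriv[OF diff] by (rule norm_sum)
    also have "\<dots> \<le> (\<Sum>i\<in>Basis. norm w * B i)"
      unfolding norm_scaleR by (intro sum_mono mult_mono bound) (auto simp: Basis_le_norm)
    finally show ?thesis by (simp add: sum_distrib_left mult.commute)
  qed
  then show "onorm (frechet_derivative g (at x)) \<le> (\<Sum>i\<in>Basis. B i)"
    by (rule onorm_le)
qed auto

text \<open>The first-order terms at \<open>x\<close> and \<open>- x\<close> cancel, and bounded
  second derivatives control what remains. This quadratic bound is the source of the order
  \<open>u powr (2 / a)\<close>.\<close>

lemma schwartz_second_difference:
  fixes f :: "'a::euclidean_space \<Rightarrow> complex"
  assumes f: "f \<in> schwartz"
  obtains C where "\<And>x. norm (f x + f (- x) - 2 * f 0) \<le> C * (norm x)\<^sup>2"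
proof -
  have diff: "f differentiable (at x)" for x
    using schwartz_differentiable[OF f, of "[]"] by (simp add: iter_deriv_def)
  have diff1: "dir_deriv i f differentiable (at x)" if "i \<in> Basis" for i x
    using schwartz_differentiable[OF f, of "[i]"] that by (simp add: iter_deriv_def)
  \<comment> \<open>Bounded second partial derivatives make the first ones Lipschitz.\<close>
  have "\<exists>L. \<forall>x y. norm (dir_deriv i f x - dir_deriv i f y) \<le> L * norm (x - y)" if i: "i \<in> Basis" for i
  proof -
    have "\<exists>B. \<forall>x. norm (dir_deriv j (dir_deriv i f) x) \<le> B" if "j \<in> Basis" for j
      using schwartz_iter_deriv_rapidly_decreasing[OF f, of "[j, i]"] that i
      by (auto simp: iter_deriv_def) (meson rapidly_decreasing_imp_bounded)
    then obtain B where "\<And>j x. j \<in> Basis \<Longrightarrow> norm (dir_deriv j (dir_deriv i f) x) \<le> B j"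
      by metis
    from bounded_partials_imp_lipschitz[OF diff1[OF i] this] show ?thesis by blast
  qed
  then obtain L where L: "\<And>i x y. i \<in> Basis \<Longrightarrow> norm (dir_deriv i f x - dir_deriv i f y) \<le> L i * norm (x - y)"
    by metis
  define C where "C = 2 * (\<Sum>i\<in>Basis. L i)"
  have "norm (f x + f (- x) - 2 * f 0) \<le> C * (norm x)\<^sup>2" for x
  proof -
    define D where "D = (\<lambda>y. frechet_derivative f (at y))"
    \<comment> \<open>\<open>\<phi> 1 - \<phi> 0\<close> is the second difference, and the
      derivative of \<open>\<phi>\<close> compares the derivatives of \<open>f\<close> at two
      antipodal points, whose distance is at most \<open>2 * norm x\<close>.\<close>
    define \<phi> where "\<phi> = (\<lambda>r::real. f (r *\<^sub>R x) + f (- (r *\<^sub>R x)))"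
    have D: "(f has_derivative D y) (at y)" for y
      unfolding D_def using diff frechet_derivative_works by blast
    have lin: "linear (D y)" for y
      unfolding D_def using diff by (rule linear_frechet_derivative)
    have der: "(\<phi> has_derivative (\<lambda>t. t *\<^sub>R (D (r *\<^sub>R x) x - D (- (r *\<^sub>R x)) x))) (at r within {0..1})" for r
    proof -
      have "(\<phi> has_derivative (\<lambda>t. D (r *\<^sub>R x) (t *\<^sub>R x) + D (- (r *\<^sub>R x)) (- (t *\<^sub>R x)))) (at r within {0..1})"
        unfolding \<phi>_def
        by (intro has_derivative_add has_derivative_compose[OF _ D]) (auto intro!: derivative_eq_intros)
      then show ?thesis
        by (simp add: linear_scale[OF lin] linear_neg[OF lin] scaleR_diff_right)
    qed
    have "norm (\<phi> 1 - \<phi> 0) \<le> (C * (norm x)\<^sup>2) * norm (1 - 0 :: real)"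
    proof (rule differentiable_bound[OF _ der])
      fix r :: real assume r: "r \<in> {0..1}"
      have "norm (D (r *\<^sub>R x) x - D (- (r *\<^sub>R x)) x)
          = norm (\<Sum>i\<in>Basis. (x \<bullet> i) *\<^sub>R (dir_deriv i f (r *\<^sub>R x) - dir_deriv i f (- (r *\<^sub>R x))))"
        unfolding D_def frechet_derivative_eq_sum_dir_deriv[OF diff]
        by (simp add: sum_subtractf scaleR_diff_right)
      also have "\<dots> \<le> (\<Sum>i\<in>Basis. norm ((x \<bullet> i) *\<^sub>R (dir_deriv i f (r *\<^sub>R x) - dir_deriv i f (- (r *\<^sub>R x)))))"
        by (rule norm_sum)
      also have "\<dots> \<le> (\<Sum>i\<in>Basis. norm x * (L i * (2 * norm x)))"
      proof (rule sum_mono)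
        fix i :: 'a assume i: "i \<in> Basis"
        have L0: "L i \<ge> 0"
          using L[OF i, of i 0] i by (smt (verit) norm_ge_zero norm_Basis diff_zero mult_cancel_left1)
        have "norm (dir_deriv i f (r *\<^sub>R x) - dir_deriv i f (- (r *\<^sub>R x))) \<le> L i * norm (r *\<^sub>R x - - (r *\<^sub>R x))"
          by (rule L[OF i])
        also have "norm (r *\<^sub>R x - - (r *\<^sub>R x)) = 2 * \<bar>r\<bar> * norm x"
          by (simp add: abs_mult flip: scaleR_2)
        also have "L i * (2 * \<bar>r\<bar> * norm x) \<le> L i * (2 * norm x)"
          using r L0 by (intro mult_left_mono) (auto simp: mult_left_le_one_le)
        finally show "norm ((x \<bullet> i) *\<^sub>R (dir_deriv i f (r *\<^sub>R x) - dir_deriv i f (- (r *\<^sub>R x)))) \<le> norm x * (L i * (2 * norm x))"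
          unfolding norm_scaleR using i by (intro mult_mono) (auto simp: Basis_le_norm)
      qed
      also have "\<dots> = C * (norm x)\<^sup>2"
        by (simp add: C_def sum_distrib_left sum_distrib_right power2_eq_square mult_ac)
      finally have b: "norm (D (r *\<^sub>R x) x - D (- (r *\<^sub>R x)) x) \<le> C * (norm x)\<^sup>2" .
      show "onorm (\<lambda>t. t *\<^sub>R (D (r *\<^sub>R x) x - D (- (r *\<^sub>R x)) x)) \<le> C * (norm x)\<^sup>2"
        using mult_left_mono[OF b abs_ge_zero] by (intro onorm_le) (simp add: mult.commute)
    qed auto
    then show ?thesis by (simp add: \<phi>_def)
  qed
  then show ?thesis using that by blast
qed

section \<open>The Gaussian as a Schwartz function\<close>

definition gauss_poly :: "('a::euclidean_space \<Rightarrow> real) \<Rightarrow> 'a \<Rightarrow> complex" where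
  "gauss_poly p x = of_real (p x * exp (- (x \<bullet> x)))"

text \<open>Induction on the polynomial with the product rule. Keeping the full derivative
  \<open>D\<close> in the statement records differentiability together with the polynomial
  \<open>p'\<close>.\<close>

lemma real_polynomial_function_dir_deriv:
  assumes "real_polynomial_function p"
  shows "\<exists>p'. real_polynomial_function p' \<and> (\<forall>x. \<exists>D. (p has_derivative D) (at x) \<and> D b = p' x)"
  using assms
proof induction
  case (linear f)
  then show ?case
    by (intro exI[of _ "\<lambda>_. f b"]) (auto intro: bounded_linear_imp_has_derivative)
next
  case (const c)
  show ?case by (intro exI[of _ "\<lambda>_. 0"]) (auto intro!: exI[of _ "\<lambda>_. 0"])
next
  case (add f g)
  then obtain f' g' where *: "real_polynomial_function f'" "real_polynomial_function g'"
    "\<And>x. \<exists>D. (f has_derivative D) (at x) \<and> D b = f' x" "\<And>x. \<exists>D. (g has_derivative D) (at x) \<and> D b = g' x"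
    by blast
  show ?case
  proof (rule exI[of _ "\<lambda>x. f' x + g' x"], intro conjI allI)
    fix x
    obtain D E where "(f has_derivative D) (at x)" "D b = f' x" "(g has_derivative E) (at x)" "E b = g' x"
      using * by blast
    then show "\<exists>D. ((\<lambda>x. f x + g x) has_derivative D) (at x) \<and> D b = f' x + g' x"
      by (intro exI[of _ "\<lambda>w. D w + E w"]) (auto intro: has_derivative_add)
  qed (use * in auto)
next
  case (mult f g)
  then obtain f' g' where *: "real_polynomial_function f'" "real_polynomial_function g'"
    "\<And>x. \<exists>D. (f has_derivative D) (at x) \<and> D b = f' x" "\<And>x. \<exists>D. (g has_derivative D) (at x) \<and> D b = g' x"
    by blast
  show ?case
  proof (rule exI[of _ "\<lambda>x. f x * g' x + f' x * g x"], intro conjI allI)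
    fix x
    obtain D E where "(f has_derivative D) (at x)" "D b = f' x" "(g has_derivative E) (at x)" "E b = g' x"
      using * by blast
    then show "\<exists>D. ((\<lambda>x. f x * g x) has_derivative D) (at x) \<and> D b = f x * g' x + f' x * g x"
      by (intro exI[of _ "\<lambda>w. f x * E w + D w * g x"]) (auto intro: has_derivative_mult)
  qed (use * mult.hyps in auto)
qed

text \<open>Real polynomials times the Gaussian form a class stable under directional derivatives;
  induction on the list then handles all iterated derivatives.\<close>

lemma gauss_poly_dir_deriv:
  fixes p :: "'a::euclidean_space \<Rightarrow> real"
  assumes p: "real_polynomial_function p"
  shows "gauss_poly p differentiable (at x)"
    and "\<exists>q. real_polynomial_function q \<and> dir_deriv b (gauss_poly p) = gauss_poly q"
proof -
  obtain p' where p': "real_polynomial_function p'" "\<And>x. \<exists>D. (p has_derivative D) (at x) \<and> D b = p' x"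
    using real_polynomial_function_dir_deriv[OF p] by blast
  \<comment> \<open>The second summand comes from differentiating
    \<open>exp (- (x \<bullet> x))\<close> in the direction \<open>b\<close>.\<close>
  define q where "q = (\<lambda>x. p' x + (- 2) * ((x \<bullet> b) * p x))"
  have q: "real_polynomial_function q"
    unfolding q_def using p p'(1)
    by (intro real_polynomial_function.intros(2-4)
        real_polynomial_function.intros(1)[OF bounded_linear_inner_left])
  have *: "\<exists>E. (gauss_poly p has_derivative E) (at x) \<and> E b = gauss_poly q x" for x
  proof -
    obtain D where D: "(p has_derivative D) (at x)" "D b = p' x" using p' by blast
    have "((\<lambda>x. p x * exp (- (x \<bullet> x))) has_derivative
        (\<lambda>w. p x * (exp (- (x \<bullet> x)) * - (x \<bullet> w + w \<bullet> x)) + D w * exp (- (x \<bullet> x)))) (at x)"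
      by (rule derivative_eq_intros D(1) refl)+ (simp add: fun_eq_iff algebra_simps)
    from has_derivative_of_real[OF this]
    show ?thesis unfolding gauss_poly_def
      by (intro exI conjI, assumption)
        (simp add: D(2) q_def inner_commute algebra_simps)
  qed
  from *[of x] show "gauss_poly p differentiable (at x)" by (auto simp: differentiable_def)
  have "dir_deriv b (gauss_poly p) x = gauss_poly q x" for x
    using *[of x] frechet_derivative_at by (fastforce simp: dir_deriv_def)
  with q show "\<exists>q. real_polynomial_function q \<and> dir_deriv b (gauss_poly p) = gauss_poly q"
    by blast
qed

text \<open>Since \<open>1 + norm x \<ge> 1\<close>, its powers increase with the exponent, so
  adding the exponents works for sums as well as for products.\<close>

lemma real_polynomial_function_growth:
  assumes "real_polynomial_function p"
  shows "\<exists>C n. C \<ge> 0 \<and> (\<forall>x. \<bar>p x\<bar> \<le> C * (1 + norm x) ^ n)"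
  using assms
proof induction
  case (linear f)
  then obtain K where K: "K > 0" "\<And>x. norm (f x) \<le> norm x * K" using bounded_linear.pos_bounded by blast
  have "\<bar>f x\<bar> \<le> K * (1 + norm x) ^ 1" for x
    using K(2)[of x] K(1) by (simp add: algebra_simps)
  then show ?case using K(1) less_imp_le by blast
next
  case (const c)
  have "\<bar>c\<bar> \<le> \<bar>c\<bar> * (1 + norm x) ^ 0" for x :: 'a by simp
  then show ?case by (meson abs_ge_zero)
next
  case (add f g)
  then obtain C m D n where C: "C \<ge> 0" "\<And>x. \<bar>f x\<bar> \<le> C * (1 + norm x) ^ m"
    and D: "D \<ge> 0" "\<And>x. \<bar>g x\<bar> \<le> D * (1 + norm x) ^ n" by blast
  have "\<bar>f x + g x\<bar> \<le> (C + D) * (1 + norm x) ^ (m + n)" for x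
  proof -
    have "C * (1 + norm x) ^ m \<le> C * (1 + norm x) ^ (m + n)" "D * (1 + norm x) ^ n \<le> D * (1 + norm x) ^ (m + n)"
      using C(1) D(1) by (auto intro!: mult_left_mono power_increasing)
    then show ?thesis using C(2)[of x] D(2)[of x] by (simp add: distrib_right)
  qed
  then show ?case using C(1) D(1) by (metis add_nonneg_nonneg)
next
  case (mult f g)
  then obtain C m D n where C: "C \<ge> 0" "\<And>x. \<bar>f x\<bar> \<le> C * (1 + norm x) ^ m"
    and D: "D \<ge> 0" "\<And>x. \<bar>g x\<bar> \<le> D * (1 + norm x) ^ n" by blast
  have "\<bar>f x * g x\<bar> \<le> (C * D) * (1 + norm x) ^ (m + n)" for x
    using mult_mono[OF C(2)[of x] D(2)[of x]] C(1) by (simp add: abs_mult power_add mult_ac)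
  then show ?case using C(1) D(1) by (metis mult_nonneg_nonneg)
qed

lemma rapidly_decreasing_gaussian: "rapidly_decreasing (\<lambda>x::'a::euclidean_space. exp (- (x \<bullet> x)))"
proof -
  have "norm x powr 2 = x \<bullet> x" for x :: 'a
    by (cases "x = 0") (simp_all add: powr_numeral power2_norm_eq_inner)
  then show ?thesis using rapidly_decreasing_exp_powr[of 1 2, where 'a='a] by simp
qed

lemma gauss_poly_rapidly_decreasing:
  fixes p :: "'a::euclidean_space \<Rightarrow> real"
  assumes "real_polynomial_function p"
  shows "rapidly_decreasing (gauss_poly p)"
proof -
  obtain C n where C: "C \<ge> 0" "\<And>x. \<bar>p x\<bar> \<le> C * (1 + norm x) ^ n"
    using real_polynomial_function_growth[OF assms] by blast
  define h where "h = (\<lambda>x::'a. exp (- (x \<bullet> x)) + norm x ^ n *\<^sub>R exp (- (x \<bullet> x)))"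
  have "rapidly_decreasing h"
    unfolding h_def by (intro rapidly_decreasing_add rapidly_decreasing_power rapidly_decreasing_gaussian)
  then show ?thesis
  proof (rule rapidly_decreasing_bounded_mult)
    fix x :: 'a
    \<comment> \<open>The sum \<open>1 + norm x\<close> is at most twice the larger of its two
      summands.\<close>
    have "(1 + norm x) ^ n \<le> 2 ^ n * (1 + norm x ^ n)"
    proof (cases "norm x \<le> 1")
      case True
      then have "(1 + norm x) ^ n \<le> 2 ^ n" by (intro power_mono) auto
      then show ?thesis by (simp add: distrib_left add_increasing2)
    next
      case False
      then have "(1 + norm x) ^ n \<le> (2 * norm x) ^ n" by (intro power_mono) auto
      then show ?thesis by (simp add: distrib_left power_mult_distrib add_increasing)
    qed
    then have "C * (1 + norm x) ^ n \<le> C * (2 ^ n * (1 + norm x ^ n))"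
      using C(1) by (rule mult_left_mono)
    then have "\<bar>p x\<bar> \<le> C * 2 ^ n * (1 + norm x ^ n)"
      using C(2)[of x] by simp
    then have "\<bar>p x\<bar> * exp (- (x \<bullet> x)) \<le> C * 2 ^ n * (1 + norm x ^ n) * exp (- (x \<bullet> x))"
      by (rule mult_right_mono) auto
    also have "\<dots> = C * 2 ^ n * norm (h x)"
      by (simp add: h_def algebra_simps add_nonneg_nonneg)
    finally show "norm (gauss_poly p x) \<le> C * 2 ^ n * norm (h x)"
      by (simp add: gauss_poly_def norm_mult del: of_real_mult) (simp add: abs_mult)
  qed
qed

lemma iter_deriv_gauss_poly:
  assumes "real_polynomial_function p"
  shows "\<exists>q. real_polynomial_function q \<and> iter_deriv es (gauss_poly p) = gauss_poly q"
proof (induction es)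
  case Nil
  then show ?case using assms by (auto simp: iter_deriv_def)
next
  case (Cons b es)
  then obtain q where q: "real_polynomial_function q" "iter_deriv es (gauss_poly p) = gauss_poly q" by blast
  have "iter_deriv (b # es) (gauss_poly p) = dir_deriv b (gauss_poly q)"
    using q(2) by (simp add: iter_deriv_def)
  then show ?case using gauss_poly_dir_deriv(2)[OF q(1)] by simp
qed

lemma gaussian_schwartz: "(\<lambda>x::'a::euclidean_space. complex_of_real (exp (- (x \<bullet> x)))) \<in> schwartz"
proof -
  have "gauss_poly (\<lambda>_::'a. 1) \<in> schwartz"
    unfolding schwartz_def
  proof (clarsimp, intro conjI allI)
    fix es :: "'a list"
    obtain q where q: "real_polynomial_function q" "iter_deriv es (gauss_poly (\<lambda>_. 1)) = gauss_poly q"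
      using iter_deriv_gauss_poly[OF real_polynomial_function.intros(2)] by blast
    show "iter_deriv es (gauss_poly (\<lambda>_. 1)) differentiable at x" for x
      unfolding q(2) by (rule gauss_poly_dir_deriv(1)[OF q(1)])
    show "bounded (range (\<lambda>x. norm x ^ k *\<^sub>R iter_deriv es (gauss_poly (\<lambda>_. 1)) x))" for k
      unfolding q(2) using gauss_poly_rapidly_decreasing[OF q(1)]
      by (auto simp: bounded_iff rapidly_decreasing_def)
  qed
  then show ?thesis by (simp add: gauss_poly_def[abs_def])
qed

section \<open>The generating function of the Laguerre polynomials\<close>

text \<open>The binomial series at \<open>- z\<close> with upper index \<open>- (b + 1)\<close>,
  whose coefficients equal \<open>(- 1) ^ j\<close> times \<open>(b + j) gchoose j\<close>.\<close>

lemma binomial_series_complex: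
  fixes z b :: complex
  assumes "norm z < 1"
  shows "(\<lambda>j. ((b + of_nat j) gchoose j) * z ^ j) sums ((1 - z) powr (- (b + 1)))"
proof -
  have "(\<lambda>j. (- (b + 1) gchoose j) * (- z) ^ j) sums ((1 - z) powr (- (b + 1)))"
    using gen_binomial_complex[of "- z" "- (b + 1)"] assms by simp
  then show ?thesis
    by (simp only: gbinomial_minus' power_minus[of z] mult_ac)
qed

lemma binomial_series_real:
  fixes r b :: real
  assumes "\<bar>r\<bar> < 1"
  shows "(\<lambda>j. ((b + real j) gchoose j) * r ^ j) sums ((1 - r) powr (- (b + 1)))"
proof -
  have "(\<lambda>j. (- (b + 1) gchoose j) * (- r) ^ j) sums ((1 - r) powr (- (b + 1)))"
    using gen_binomial_real[of "- r" "- (b + 1)"] assms by simp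
  then show ?thesis
    by (simp only: gbinomial_minus' power_minus[of r] mult_ac)
qed

lemma of_real_gbinomial: "(of_real (a gchoose k) :: complex) = of_real a gchoose k"
  unfolding gbinomial_prod_rev by simp

text \<open>Each factor of the numerator has the form \<open>b + j - i\<close> with
  \<open>i < j\<close>, hence is at least \<open>b + 1 > 0\<close>.\<close>

lemma gbinomial_shift_nonneg:
  assumes "b > (-1 :: real)"
  shows "(b + real j) gchoose j \<ge> 0"
  unfolding gbinomial_prod_rev
  using assms by (intro divide_nonneg_nonneg prod_nonneg) auto

lemma has_sum_exp: "((\<lambda>k. w ^ k / fact k) has_sum exp w) UNIV" for w :: complex
proof (rule norm_summable_imp_has_sum)
  show "summable (\<lambda>n. norm (w ^ n / fact n))"
    using summable_norm_exp[of w] by (simp add: norm_mult norm_inverse norm_power divide_inverse mult.commute)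
  show "(\<lambda>k. w ^ k / fact k) sums exp w"
    using exp_converges[of w] by (simp add: scaleR_conv_of_real divide_inverse mult.commute)
qed

text \<open>Expanding the Laguerre polynomials and setting \<open>l = k + j\<close> gives a double
  series. Its sum over \<open>j\<close> is a binomial series with parameter
  \<open>\<nu> + k\<close>, and the remaining sum over \<open>k\<close> is the exponential series in
  \<open>- x * z / (1 - z)\<close>.\<close>

lemma laguerre_generating_function:
  fixes z :: complex
  assumes nu: "\<nu> > -1" and z: "norm z < 1"
  shows "((\<lambda>l. of_real (laguerre l \<nu> x) * z ^ l) has_sum
           ((1 - z) powr (- (of_real \<nu> + 1)) * exp (- (of_real x * z / (1 - z))))) UNIV"
proof -
  define c where "c = (\<lambda>k j. (\<nu> + real k + real j) gchoose j)"
  define T where "T = (\<lambda>(k::nat, j::nat). of_real (- x) ^ k / fact k * (of_real (c k j) * z ^ (k + j)))"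
  define g where "g = (\<lambda>k. (- (of_real x * z / (1 - z))) ^ k / fact k * (1 - z) powr (- (of_real \<nu> + 1)))"
  \<comment> \<open>This is \<open>g\<close> with \<open>norm z\<close> in place of \<open>z\<close>
    and \<open>- \<bar>x\<bar>\<close> in place of \<open>x\<close>. As the coefficients
    \<open>c k j\<close> are nonnegative for \<open>\<nu> > -1\<close>, it is the sum of the norms
    over \<open>j\<close>, and its summability gives the absolute convergence of the double
    series.\<close>
  define h where "h = (\<lambda>k. (\<bar>x\<bar> * norm z / (1 - norm z)) ^ k / fact k * (1 - norm z) powr (- (\<nu> + 1)))"
  have z1: "z \<noteq> 1" using z by auto
  have c_nonneg: "c k j \<ge> 0" for k j
    using gbinomial_shift_nonneg[of "\<nu> + real k" j] nu by (simp add: c_def)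
  have norm_inner: "(\<lambda>j. norm (T (k, j))) sums h k" for k
  proof -
    have "(\<lambda>j. c k j * norm z ^ j) sums ((1 - norm z) powr (- (\<nu> + real k + 1)))"
      unfolding c_def using z by (intro binomial_series_real) auto
    then have "(\<lambda>j. \<bar>x\<bar> ^ k / fact k * norm z ^ k * (c k j * norm z ^ j)) sums
        (\<bar>x\<bar> ^ k / fact k * norm z ^ k * (1 - norm z) powr (- (\<nu> + real k + 1)))"
      by (rule sums_mult)
    moreover have "\<bar>x\<bar> ^ k / fact k * norm z ^ k * (1 - norm z) powr (- (\<nu> + real k + 1)) = h k"
    proof -
      have "(1 - norm z) powr (- (\<nu> + real k + 1)) = (1 - norm z) powr (- (\<nu> + 1)) / (1 - norm z) ^ k"
        using z by (simp add: powr_diff powr_realpow powr_minus powr_add field_simps)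
      then show ?thesis by (simp add: h_def power_mult_distrib power_divide)
    qed
    moreover have "norm (T (k, j)) = \<bar>x\<bar> ^ k / fact k * norm z ^ k * (c k j * norm z ^ j)" for j
      using c_nonneg[of k j] by (simp add: T_def norm_mult norm_divide norm_power power_add)
    ultimately show ?thesis by simp
  qed
  have inner: "((\<lambda>j. T (k, j)) has_sum g k) UNIV" for k
  proof (rule norm_summable_imp_has_sum)
    show "summable (\<lambda>j. norm (T (k, j)))" using norm_inner by (rule sums_summable)
    have "(\<lambda>j. of_real (c k j) * z ^ j) sums ((1 - z) powr (- (of_real \<nu> + of_nat k + 1)))"
      using binomial_series_complex[OF z, of "of_real \<nu> + of_nat k"]
      by (simp add: c_def of_real_gbinomial)
    then have "(\<lambda>j. of_real (- x) ^ k / fact k * z ^ k * (of_real (c k j) * z ^ j)) sums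
        (of_real (- x) ^ k / fact k * z ^ k * (1 - z) powr (- (of_real \<nu> + of_nat k + 1)))"
      by (rule sums_mult)
    moreover have "of_real (- x) ^ k / fact k * z ^ k * (1 - z) powr (- (of_real \<nu> + of_nat k + 1)) = g k"
    proof -
      have "(1 - z) powr (- (of_real \<nu> + of_nat k + 1)) = (1 - z) powr (- (of_real \<nu> + 1) - of_nat k)"
        by (simp add: algebra_simps)
      also have "\<dots> = (1 - z) powr (- (of_real \<nu> + 1)) / (1 - z) ^ k"
        using z1 by (simp only: powr_diff powr_nat') (simp add: powr_nat)
      finally have e: "(1 - z) powr (- (of_real \<nu> + of_nat k + 1)) = (1 - z) powr (- (of_real \<nu> + 1)) / (1 - z) ^ k" .
      have "(- (of_real x * z / (1 - z))) ^ k = of_real (- x) ^ k * z ^ k / (1 - z) ^ k"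
        by (simp flip: power_mult_distrib power_divide)
      then show ?thesis unfolding g_def e by simp
    qed
    ultimately show "(\<lambda>j. T (k, j)) sums g k"
      by (simp add: T_def power_add mult_ac)
  qed
  have "summable h"
    unfolding h_def
    using summable_exp_generic[of "\<bar>x\<bar> * norm z / (1 - norm z)"]
    by (intro summable_mult2) (simp add: field_simps)
  moreover have h_nonneg: "h k \<ge> 0" for k
    using z by (simp add: h_def)
  moreover have "infsum (\<lambda>j. norm (T (k, j))) UNIV = h k" for k
    by (rule infsumI, rule norm_summable_imp_has_sum) (use norm_inner sums_summable in auto)
  ultimately have "(\<lambda>p. norm (T p)) summable_on (UNIV \<times> UNIV)"
    by (subst Infinite_Sum.abs_summable_on_Sigma_iff)
       (auto intro!: norm_summable_imp_summable_on sums_summable[OF norm_inner])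
  then have T_summable: "T summable_on (UNIV \<times> UNIV)"
    by (rule Infinite_Sum.abs_summable_summable)
  define S where "S = (1 - z) powr (- (of_real \<nu> + 1)) * exp (- (of_real x * z / (1 - z)))"
  have "(g has_sum S) UNIV"
    unfolding g_def S_def mult.commute[of "_ powr _"] by (intro has_sum_cmult_left has_sum_exp)
  then have "(T has_sum S) (UNIV \<times> UNIV)"
    using inner T_summable by (intro has_sum_SigmaI) auto
  moreover have "(T has_sum S) (UNIV \<times> UNIV) \<longleftrightarrow>
      ((\<lambda>(l, k). T (k, l - k)) has_sum S) (SIGMA l:UNIV. {..l})"
    \<comment> \<open>The double series is regrouped along the diagonals
      \<open>k + j = l\<close>.\<close>
    by (rule has_sum_reindex_bij_witness[of _ "\<lambda>(l, k). (k, l - k)" "\<lambda>(k, j). (k + j, k)"]) auto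
  ultimately have "((\<lambda>(l, k). T (k, l - k)) has_sum S) (SIGMA l:UNIV. {..l})"
    by simp
  then have "((\<lambda>l. \<Sum>k\<le>l. T (k, l - k)) has_sum S) UNIV"
    by (rule has_sum_SigmaD) (auto intro: has_sum_finite)
  moreover have "(\<Sum>k\<le>l. T (k, l - k)) = of_real (laguerre l \<nu> x) * z ^ l" for l
  proof -
    have "T (k, l - k) = of_real ((- 1) ^ k * ((\<nu> + real l) gchoose (l - k)) * x ^ k / fact k) * z ^ l"
      if "k \<le> l" for k
    proof -
      have "\<nu> + real k + real (l - k) = \<nu> + real l" using that by simp
      moreover have "(- complex_of_real x) ^ k = (- 1) ^ k * of_real x ^ k" by (rule power_minus)
      ultimately show ?thesis using that by (simp add: T_def c_def)
    qed
    then show ?thesis by (simp add: laguerre_def sum_distrib_right)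
  qed
  ultimately show ?thesis by (simp add: S_def)
qed

text \<open>The profile of the radial eigenfunctions in the variable
  \<open>s = norm x powr a / a\<close>; the argument \<open>2 * s\<close> is then
  \<open>2 / a * norm x powr a\<close>.\<close>

definition laguerre_fun :: "nat \<Rightarrow> real \<Rightarrow> real \<Rightarrow> real" where
  "laguerre_fun l \<nu> s = laguerre l \<nu> (2 * s) * exp (- s)"

text \<open>The factor \<open>exp (- s)\<close> turns the exponent into \<open>- s\<close> times the
  Cayley transform \<open>(1 + z) / (1 - z)\<close>, which becomes its reciprocal when
  \<open>z\<close> changes sign.\<close>

lemma laguerre_fun_generating_function:
  fixes z :: complex
  assumes nu: "\<nu> > -1" and z: "norm z < 1"
  shows "(\<lambda>l. of_real (laguerre_fun l \<nu> s) * z ^ l) sums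
           ((1 - z) powr (- (of_real \<nu> + 1)) * exp (- (of_real s * (1 + z) / (1 - z))))"
proof -
  have "z \<noteq> 1" using z by auto
  then have e: "- (of_real (2 * s) * z / (1 - z)) + of_real (- s) = - (of_real s * (1 + z) / (1 - z))"
    by (simp add: field_simps)
  have "(\<lambda>l. of_real (laguerre l \<nu> (2 * s)) * z ^ l) sums
           ((1 - z) powr (- (of_real \<nu> + 1)) * exp (- (of_real (2 * s) * z / (1 - z))))"
    using laguerre_generating_function[OF nu z, of "2 * s"] by (rule has_sum_imp_sums)
  from sums_mult2[OF this, of "exp (of_real (- s))"]
  have "(\<lambda>l. of_real (laguerre l \<nu> (2 * s)) * z ^ l * exp (of_real (- s))) sums
           ((1 - z) powr (- (of_real \<nu> + 1)) * exp (- (of_real (2 * s) * z / (1 - z)) + of_real (- s)))"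
    by (simp only: exp_add mult.assoc)
  then show ?thesis
    unfolding e by (simp add: laguerre_fun_def exp_of_real[symmetric] mult_ac)
qed

text \<open>After multiplication by the conjugate of the denominator, the real part has numerator
  \<open>1 - (norm z)\<^sup>2\<close>.\<close>

lemma Re_cayley_nonneg:
  fixes z :: complex
  assumes "norm z < 1"
  shows "Re ((1 + z) / (1 - z)) \<ge> 0"
proof -
  have "(Re z)\<^sup>2 + (Im z)\<^sup>2 \<le> 1"
    using assms cmod_power2[of z] by (smt (verit) norm_ge_zero power_le_one)
  then have "0 \<le> (1 + Re z) * (1 - Re z) - Im z * Im z"
    by (simp add: algebra_simps power2_eq_square)
  then show ?thesis
    by (simp add: Re_divide)
qed

text \<open>
  On the circle of radius \<open>\<rho> < 1\<close> the generating function is bounded independently of \<open>s\<close>, since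
  \<open>(1 + z) / (1 - z)\<close> has nonnegative real part there.
\<close>

lemma abs_laguerre_fun_le:
  assumes nu: "\<nu> > -1" and s: "s \<ge> 0" and \<rho>: "0 < \<rho>" "\<rho> < 1"
  shows "\<bar>laguerre_fun l \<nu> s\<bar> \<le> (1 - \<rho>) powr (- (\<nu> + 1)) / \<rho> ^ l"
proof -
  define H where "H = (\<lambda>z. (1 - z) powr (- (of_real \<nu> + 1)) * exp (- (of_real s * (1 + z) / (1 - z))) :: complex)"
  have sums: "(\<lambda>l. of_real (laguerre_fun l \<nu> s) * z ^ l) sums H z" if "norm z < 1" for z
    unfolding H_def using laguerre_fun_generating_function[OF nu that] .
  have "H has_fps_expansion Abs_fps (\<lambda>l. of_real (laguerre_fun l \<nu> s))"
  proof (rule has_fps_expansionI)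
    have "eventually (\<lambda>u. u \<in> ball 0 1) (nhds (0::complex))"
      by (rule eventually_nhds_in_open) auto
    then show "\<forall>\<^sub>F u in nhds 0. (\<lambda>n. fps_nth (Abs_fps (\<lambda>l. complex_of_real (laguerre_fun l \<nu> s))) n * u ^ n) sums H u"
      by eventually_elim (simp add: sums)
  qed
  from fps_nth_fps_expansion[OF this, of l]
  have coeff: "complex_of_real (laguerre_fun l \<nu> s) = (deriv ^^ l) H 0 / fact l" by simp
  have hol: "H holomorphic_on ball 0 1"
    unfolding H_def
  proof (intro holomorphic_intros)
    fix z :: complex assume z: "z \<in> ball 0 1"
    then show "1 - z \<notin> \<real>\<^sub>\<le>\<^sub>0"
      using complex_Re_le_cmod[of z] by (auto simp: complex_nonpos_Reals_iff)
    show "1 - z \<noteq> 0" using z by auto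
  qed
  \<comment> \<open>Cauchy's estimate on the circle of radius \<open>\<rho>\<close> bounds the
    \<open>l\<close>-th Taylor coefficient of the generating function.\<close>
  have "norm ((deriv ^^ l) H 0) \<le> fact l * (1 - \<rho>) powr (- (\<nu> + 1)) / \<rho> ^ l"
  proof (rule Cauchy_inequality)
    show "H holomorphic_on ball 0 \<rho>"
      using hol \<rho> by (rule_tac holomorphic_on_subset) auto
    show "continuous_on (cball 0 \<rho>) H"
      using hol \<rho> by (intro holomorphic_on_imp_continuous_on) (rule holomorphic_on_subset, auto)
    fix z :: complex assume "norm (0 - z) = \<rho>"
    then have z: "norm z = \<rho>" by simp
    then have nz: "norm z < 1" "z \<noteq> 1" using \<rho> by auto
    have "norm ((1 - z) powr (- (of_real \<nu> + 1))) = norm (1 - z) powr (- (\<nu> + 1))"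
      using norm_powr_real_powr'[of "- (of_real \<nu> + 1)" "1 - z"] by simp
    also have "\<dots> \<le> (1 - \<rho>) powr (- (\<nu> + 1))"
      using nu \<rho> z norm_triangle_ineq2[of 1 z] by (intro powr_mono2') auto
    finally have 1: "norm ((1 - z) powr (- (of_real \<nu> + 1))) \<le> (1 - \<rho>) powr (- (\<nu> + 1))" .
    have "Re (of_real s * (1 + z) / (1 - z)) = s * Re ((1 + z) / (1 - z))"
      by (simp only: times_divide_eq_right[symmetric] times_complex.sel) simp
    then have "norm (exp (- (of_real s * (1 + z) / (1 - z)))) \<le> 1"
      using Re_cayley_nonneg[OF nz(1)] s by (simp add: norm_exp_eq_Re)
    with 1 have "norm (H z) \<le> (1 - \<rho>) powr (- (\<nu> + 1)) * 1"
      unfolding H_def norm_mult by (intro mult_mono) auto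
    then show "norm (H z) \<le> (1 - \<rho>) powr (- (\<nu> + 1))" by simp
  qed (use \<rho> in auto)
  then have "norm (complex_of_real (laguerre_fun l \<nu> s)) \<le> (1 - \<rho>) powr (- (\<nu> + 1)) / \<rho> ^ l"
    unfolding coeff norm_divide by (simp add: field_simps)
  then show ?thesis by simp
qed

lemma laguerre_fun_generating_function_real:
  assumes nu: "\<nu> > -1" and r: "\<bar>r\<bar> < 1"
  shows "(\<lambda>l. laguerre_fun l \<nu> s * r ^ l) sums
           ((1 - r) powr (- (\<nu> + 1)) * exp (- (s * (1 + r) / (1 - r))))"
proof -
  have "(\<lambda>l. complex_of_real (laguerre_fun l \<nu> s * r ^ l)) sums
           ((1 - of_real r) powr (- (of_real \<nu> + 1)) * exp (- (of_real s * (1 + of_real r) / (1 - of_real r))))"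
    using laguerre_fun_generating_function[OF nu, of "of_real r" s] r by simp
  also have "(1 - complex_of_real r) powr (- (of_real \<nu> + 1)) = of_real ((1 - r) powr (- (\<nu> + 1)))"
    using powr_of_real[of "1 - r" "- (\<nu> + 1)"] r by simp
  also have "exp (- (of_real s * (1 + complex_of_real r) / (1 - of_real r)))
      = of_real (exp (- (s * (1 + r) / (1 - r))))"
    by (simp flip: exp_of_real)
  finally have "(\<lambda>l. complex_of_real (laguerre_fun l \<nu> s * r ^ l)) sums
      complex_of_real ((1 - r) powr (- (\<nu> + 1)) * exp (- (s * (1 + r) / (1 - r))))"
    by simp
  then show ?thesis by (simp only: sums_of_real_iff)
qed

lemma borel_measurable_laguerre_fun [measurable]: "laguerre_fun l \<nu> \<in> borel_measurable borel"
  unfolding laguerre_fun_def laguerre_def by measurable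

section \<open>The weighted measure\<close>

lemma integral_lborel_scaleR:
  fixes k :: "'a::euclidean_space \<Rightarrow> 'b::{banach, second_countable_topology}"
  assumes c: "c \<noteq> 0" and [measurable]: "k \<in> borel_measurable borel"
  shows "(LINT x|lborel. k x) = \<bar>c\<bar> ^ DIM('a) *\<^sub>R (LINT x|lborel. k (c *\<^sub>R x))"
proof -
  have "(LINT x|lborel. k x) = (LINT x|density (distr lborel borel (\<lambda>x. 0 + c *\<^sub>R x)) (\<lambda>_. ennreal (\<bar>c\<bar> ^ DIM('a))). k x)"
    using lborel_affine[OF c, of "0::'a"] by (simp add: ennreal_power)
  also have "\<dots> = (LINT x|distr lborel borel (\<lambda>x. 0 + c *\<^sub>R x). \<bar>c\<bar> ^ DIM('a) *\<^sub>R k x)"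
    by (subst integral_density) auto
  also have "\<dots> = (LINT x|lborel. \<bar>c\<bar> ^ DIM('a) *\<^sub>R k (c *\<^sub>R x))"
    by (subst integral_distr) auto
  finally show ?thesis by simp
qed

lemma AE_lborel_hyperplane:
  assumes "\<alpha> \<noteq> (0::'a::euclidean_space)"
  shows "AE x in lborel. \<alpha> \<bullet> x \<noteq> 0"
proof -
  have "negligible {x. \<alpha> \<bullet> x = 0}" using assms by (intro negligible_hyperplane) auto
  then have "{x. \<alpha> \<bullet> x = 0} \<in> null_sets lborel"
    by (simp add: null_sets_completion_iff negligible_iff_null_sets)
  then show ?thesis by (auto dest: AE_not_in)
qed

lemma dunkl_weight_nonneg: "dunkl_weight \<Omega> \<kappa> x \<ge> 0"
  by (simp add: dunkl_weight_def prod_nonneg)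

lemma gen_weight_nonneg: "gen_weight \<Omega> \<kappa> a x \<ge> 0"
  by (simp add: gen_weight_def dunkl_weight_nonneg)

lemma borel_measurable_gen_weight [measurable]: "gen_weight \<Omega> \<kappa> a \<in> borel_measurable borel"
  unfolding gen_weight_def dunkl_weight_def by measurable

lemma gen_const_nonneg: "gen_const \<Omega> \<kappa> a \<ge> 0"
  unfolding gen_const_def by (auto intro!: integral_nonneg_AE simp: gen_weight_nonneg)

lemma sets_gen_measure [simp, measurable_cong]: "sets (gen_measure \<Omega> \<kappa> a) = sets borel"
  by (simp add: gen_measure_def)

lemma integral_gen_measure:
  fixes h :: "'a::euclidean_space \<Rightarrow> 'b::{banach, second_countable_topology}"
  assumes [measurable]: "h \<in> borel_measurable borel"
  shows "(LINT x|gen_measure \<Omega> \<kappa> a. h x) = gen_const \<Omega> \<kappa> a *\<^sub>R (LINT x|lborel. gen_weight \<Omega> \<kappa> a x *\<^sub>R h x)"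
proof -
  have "(LINT x|gen_measure \<Omega> \<kappa> a. h x) = (LINT x|lborel. (gen_const \<Omega> \<kappa> a * gen_weight \<Omega> \<kappa> a x) *\<^sub>R h x)"
    unfolding gen_measure_def
    by (rule integral_density) (auto simp: gen_const_nonneg gen_weight_nonneg)
  then show ?thesis by (simp flip: scaleR_scaleR)
qed

lemma gen_weight_scaleR:
  assumes "c \<noteq> 0"
  shows "gen_weight \<Omega> \<kappa> a (c *\<^sub>R x) = \<bar>c\<bar> powr (a - 2 + (\<Sum>\<alpha>\<in>\<Omega>. \<kappa> \<alpha>)) * gen_weight \<Omega> \<kappa> a x"
proof (cases "finite \<Omega>")
  case True
  have "dunkl_weight \<Omega> \<kappa> (c *\<^sub>R x) = \<bar>c\<bar> powr (\<Sum>\<alpha>\<in>\<Omega>. \<kappa> \<alpha>) * dunkl_weight \<Omega> \<kappa> x"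
    using assms True by (simp add: dunkl_weight_def abs_mult powr_mult prod.distrib powr_sum)
  then show ?thesis by (simp add: gen_weight_def powr_mult powr_add mult_ac)
\<comment> \<open>For infinite \<open>\<Omega>\<close> the product defaults to 1 and the sum to 0,
  and the identity persists.\<close>
qed (simp add: gen_weight_def dunkl_weight_def powr_mult powr_add)

section \<open>Integrability, positivity and homogeneity of the measure\<close>

locale dunkl_setting =
  fixes \<Omega> :: "'a::euclidean_space set" and \<kappa> :: "'a \<Rightarrow> real" and a :: real
  assumes root_system: "root_system \<Omega>"
    and multiplicity: "nonneg_multiplicity \<Omega> \<kappa>"
    and a_pos: "a > 0"
    and index_pos: "2 * dunkl_lambda \<Omega> \<kappa> + a > 0"
begin

abbreviation "\<mu> \<equiv> gen_measure \<Omega> \<kappa> a"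

text \<open>The index usually written \<open>\<lambda>\<close> with subscripts
  \<open>\<kappa>\<close> and \<open>a\<close>; it is the Laguerre parameter of the radial
  eigenfunctions.\<close>

definition \<nu> :: real where "\<nu> = 2 * dunkl_lambda \<Omega> \<kappa> / a"

text \<open>The degree of homogeneity of \<open>gen_weight\<close>.\<close>

definition hdeg :: real where "hdeg = a - 2 + (\<Sum>\<alpha>\<in>\<Omega>. \<kappa> \<alpha>)"

definition s :: "'a \<Rightarrow> real" where "s x = norm x powr a / a"

lemma nu_gt: "\<nu> > -1"
  using index_pos a_pos by (simp add: \<nu>_def field_simps)

text \<open>The scaling exponent of \<open>\<mu>\<close>. Its value lets the dilation factor cancel
  the power of \<open>u\<close> produced by the generating function in
  \<open>integral_transform_scaled\<close>.\<close>

lemma hdeg_add_dim: "hdeg + real DIM('a) = a * (\<nu> + 1)"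
  using a_pos by (simp add: hdeg_def \<nu>_def dunkl_lambda_def mult_index_def field_simps)

lemma hdeg_pos: "hdeg + real DIM('a) > 0"
  using hdeg_add_dim nu_gt a_pos by simp

lemma s_nonneg: "s x \<ge> 0" using a_pos by (simp add: s_def)

lemma s_pos: "x \<noteq> 0 \<Longrightarrow> s x > 0" using a_pos by (simp add: s_def)

lemma s_scaleR: "s (c *\<^sub>R x) = \<bar>c\<bar> powr a * s x"
  by (simp add: s_def powr_mult)

lemma borel_measurable_s [measurable]: "s \<in> borel_measurable borel"
  unfolding s_def by measurable

lemma rapidly_decreasing_exp_s: "c > 0 \<Longrightarrow> rapidly_decreasing (\<lambda>x. exp (- (c * s x)))"
  using rapidly_decreasing_exp_powr[of "c / a" a, where 'a='a] a_pos by (simp add: s_def)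

lemma finite_roots: "finite \<Omega>" and zero_not_root: "0 \<notin> \<Omega>"
  using root_system by (auto simp: root_system_def)

text \<open>Cauchy-Schwarz for each root bounds the weight by a radial function of the same
  degree.\<close>

lemma gen_weight_le: "gen_weight \<Omega> \<kappa> a x \<le> (\<Prod>\<alpha>\<in>\<Omega>. norm \<alpha> powr \<kappa> \<alpha>) * norm x powr hdeg"
proof (cases "x = 0")
  case False
  have "dunkl_weight \<Omega> \<kappa> x \<le> (\<Prod>\<alpha>\<in>\<Omega>. (norm \<alpha> * norm x) powr \<kappa> \<alpha>)"
    unfolding dunkl_weight_def using multiplicity
    by (intro prod_mono conjI powr_mono2 Cauchy_Schwarz_ineq2) (auto simp: nonneg_multiplicity_def)
  also have "\<dots> = (\<Prod>\<alpha>\<in>\<Omega>. norm \<alpha> powr \<kappa> \<alpha>) * norm x powr (\<Sum>\<alpha>\<in>\<Omega>. \<kappa> \<alpha>)"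
    using False finite_roots by (simp add: powr_mult prod.distrib powr_sum)
  finally have "gen_weight \<Omega> \<kappa> a x \<le> norm x powr (a - 2) * ((\<Prod>\<alpha>\<in>\<Omega>. norm \<alpha> powr \<kappa> \<alpha>) * norm x powr (\<Sum>\<alpha>\<in>\<Omega>. \<kappa> \<alpha>))"
    unfolding gen_weight_def by (intro mult_left_mono) auto
  then show ?thesis by (simp add: hdeg_def powr_add mult_ac)
qed (simp add: gen_weight_def)

lemma integrable_weighted:
  fixes h :: "'a \<Rightarrow> 'b::{banach, second_countable_topology}"
  assumes h_meas [measurable]: "h \<in> borel_measurable borel" and h: "rapidly_decreasing h"
  shows "integrable lborel (\<lambda>x. gen_weight \<Omega> \<kappa> a x *\<^sub>R h x)"
proof -
  define K where "K = (\<Prod>\<alpha>\<in>\<Omega>. norm \<alpha> powr \<kappa> \<alpha>)"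
  have "integrable lborel (\<lambda>x. K *\<^sub>R (norm x powr hdeg *\<^sub>R h x))"
    using integrable_norm_powr_rapidly_decreasing[OF h_meas h hdeg_pos] by (rule integrable_scaleR_right)
  then show ?thesis
  proof (rule Bochner_Integration.integrable_bound, goal_cases)
    case 2
    have "norm (gen_weight \<Omega> \<kappa> a x *\<^sub>R h x) \<le> norm (K *\<^sub>R (norm x powr hdeg *\<^sub>R h x))" for x
    proof -
      have "gen_weight \<Omega> \<kappa> a x * norm (h x) \<le> (K * norm x powr hdeg) * norm (h x)"
        unfolding K_def by (intro mult_right_mono gen_weight_le) auto
      also have "K * norm x powr hdeg \<le> \<bar>K\<bar> * norm x powr hdeg"
        by (intro mult_right_mono) auto
      finally show ?thesis
        by (simp add: gen_weight_nonneg mult_right_mono mult.assoc abs_mult)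
    qed
    then show ?case by auto
  qed measurable
qed

lemma gen_weight_pos_AE: "AE x in lborel. x \<noteq> 0 \<and> gen_weight \<Omega> \<kappa> a x > 0"
proof -
  have "AE x in lborel. \<forall>\<alpha>\<in>\<Omega>. \<alpha> \<bullet> x \<noteq> 0"
    using finite_roots zero_not_root by (intro AE_finite_allI AE_lborel_hyperplane) auto
  moreover have "AE x::'a in lborel. x \<noteq> 0"
    by (rule AE_lborel_singleton)
  ultimately show ?thesis
    by eventually_elim (auto simp: gen_weight_def dunkl_weight_def intro!: mult_pos_pos prod_pos)
qed

text \<open>A nonnegative integrable function with zero integral vanishes almost everywhere, whereas
  the weight is positive off finitely many hyperplanes and the origin.\<close>

lemma integral_weighted_pos:
  fixes h :: "'a \<Rightarrow> real"
  assumes h_meas [measurable]: "h \<in> borel_measurable borel" and h: "rapidly_decreasing h"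
    and pos: "\<And>x. h x \<ge> 0" "\<And>x. x \<noteq> 0 \<Longrightarrow> h x > 0"
  shows "(LINT x|lborel. gen_weight \<Omega> \<kappa> a x *\<^sub>R h x) > 0"
proof -
  have nonneg: "gen_weight \<Omega> \<kappa> a x *\<^sub>R h x \<ge> 0" for x
    unfolding real_scaleR_def by (intro mult_nonneg_nonneg gen_weight_nonneg pos)
  have "(LINT x|lborel. gen_weight \<Omega> \<kappa> a x *\<^sub>R h x) \<noteq> 0"
  proof
    assume "(LINT x|lborel. gen_weight \<Omega> \<kappa> a x *\<^sub>R h x) = 0"
    then have "AE x in lborel. gen_weight \<Omega> \<kappa> a x *\<^sub>R h x = 0"
      using integral_nonneg_eq_0_iff_AE[OF integrable_weighted[OF h_meas h]] nonneg by auto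
    with gen_weight_pos_AE have "AE x::'a in lborel. False"
    proof eventually_elim
      case (elim x)
      then show False using pos(2)[of x] by auto
    qed
    then have "emeasure lborel (space lborel :: 'a set) = 0"
      by (simp add: eventually_False ae_filter_eq_bot_iff)
    then show False by simp
  qed
  moreover have "(LINT x|lborel. gen_weight \<Omega> \<kappa> a x *\<^sub>R h x) \<ge> 0"
    using nonneg by (intro integral_nonneg_AE AE_I2)
  ultimately show ?thesis by simp
qed

text \<open>The constant is the inverse of an integral, which would be 0 by default if the integrand
  were not integrable; integrability and positivity exclude this.\<close>

lemma gen_const_pos: "gen_const \<Omega> \<kappa> a > 0"
  unfolding gen_const_def
  using integral_weighted_pos[of "\<lambda>x. exp (- (1 * s x))"] rapidly_decreasing_exp_s[of 1]
  by (simp add: s_def mult.commute)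

lemma integrable_gen:
  fixes h :: "'a \<Rightarrow> 'b::{banach, second_countable_topology}"
  assumes h_meas [measurable]: "h \<in> borel_measurable borel" and h: "rapidly_decreasing h"
  shows "integrable \<mu> h"
proof -
  have "integrable lborel (\<lambda>x. gen_const \<Omega> \<kappa> a *\<^sub>R (gen_weight \<Omega> \<kappa> a x *\<^sub>R h x))"
    by (intro integrable_scaleR_right integrable_weighted assms)
  then show ?thesis
    unfolding gen_measure_def
    by (subst integrable_density) (auto simp: gen_const_nonneg gen_weight_nonneg)
qed

lemma integral_gen_pos:
  fixes h :: "'a \<Rightarrow> real"
  assumes "h \<in> borel_measurable borel" "rapidly_decreasing h"
    "\<And>x. h x \<ge> 0" "\<And>x. x \<noteq> 0 \<Longrightarrow> h x > 0"
  shows "(LINT x|\<mu>. h x) > 0"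
  using integral_weighted_pos[OF assms] gen_const_pos
  by (subst integral_gen_measure) (use assms in auto)

lemma integral_gen_scaleR:
  fixes h :: "'a \<Rightarrow> 'b::{banach, second_countable_topology}"
  assumes c: "c \<noteq> 0" and [measurable]: "h \<in> borel_measurable borel"
  shows "(LINT x|\<mu>. h x) = \<bar>c\<bar> powr (a * (\<nu> + 1)) *\<^sub>R (LINT x|\<mu>. h (c *\<^sub>R x))"
proof -
  have "(LINT x|lborel. gen_weight \<Omega> \<kappa> a x *\<^sub>R h x)
      = \<bar>c\<bar> ^ DIM('a) *\<^sub>R (LINT x|lborel. gen_weight \<Omega> \<kappa> a (c *\<^sub>R x) *\<^sub>R h (c *\<^sub>R x))"
    by (rule integral_lborel_scaleR[OF c]) measurable
  also have "\<dots> = \<bar>c\<bar> ^ DIM('a) *\<^sub>R (LINT x|lborel. \<bar>c\<bar> powr hdeg *\<^sub>R (gen_weight \<Omega> \<kappa> a x *\<^sub>R h (c *\<^sub>R x)))"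
    using c by (simp add: gen_weight_scaleR hdeg_def)
  also have "\<dots> = (\<bar>c\<bar> ^ DIM('a) * \<bar>c\<bar> powr hdeg) *\<^sub>R (LINT x|lborel. gen_weight \<Omega> \<kappa> a x *\<^sub>R h (c *\<^sub>R x))"
    by (subst integral_scaleR_right) simp
  also have "\<bar>c\<bar> ^ DIM('a) * \<bar>c\<bar> powr hdeg = \<bar>c\<bar> powr (a * (\<nu> + 1))"
    using c by (simp add: hdeg_add_dim[symmetric] powr_add powr_realpow mult.commute)
  finally show ?thesis
    by (simp add: integral_gen_measure mult.commute)
qed

end

section \<open>The transform on radial functions\<close>

text \<open>This makes the eigenfunctions with \<open>n = 0\<close> and \<open>p = 1\<close>
  available, on which the transform acts by \<open>(- 1) ^ l\<close>.\<close>

lemma dunkl_harmonic_const: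
  fixes \<Omega> :: "'a::euclidean_space set"
  shows "dunkl_harmonic \<Omega> \<kappa> 0 (\<lambda>_. c)"
proof -
  have dd: "dir_deriv \<xi> (\<lambda>_::'a. d) = (\<lambda>_. 0)" for \<xi> d
    by (simp add: dir_deriv_def fun_eq_iff)
  have rq: "reflection_quotient \<alpha> (\<lambda>_. d) = (\<lambda>_. 0)" for \<alpha> :: 'a and d
    by (auto simp: reflection_quotient_def dd)
  have op: "dunkl_op \<Omega> \<kappa> \<xi> (\<lambda>_. d) = (\<lambda>_. 0)" for \<xi> d
    by (rule ext) (simp add: dunkl_op_def dd rq)
  show ?thesis
    by (simp add: dunkl_harmonic_def homogeneous_polynomial_def dunkl_laplacian_def op)
qed

context dunkl_setting
begin

definition \<Phi> :: "nat \<Rightarrow> 'a \<Rightarrow> real" where "\<Phi> l x = laguerre_fun l \<nu> (s x)"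

lemma borel_measurable_Phi [measurable]: "\<Phi> l \<in> borel_measurable borel"
  unfolding \<Phi>_def by measurable

lemma Phi_bound: "0 < \<rho> \<Longrightarrow> \<rho> < 1 \<Longrightarrow> \<bar>\<Phi> l x\<bar> \<le> (1 - \<rho>) powr (- (\<nu> + 1)) / \<rho> ^ l"
  unfolding \<Phi>_def by (intro abs_laguerre_fun_le nu_gt s_nonneg)

lemma laguerre_harmonic_radial: "laguerre_harmonic \<Omega> \<kappa> a l 0 (\<lambda>_. 1) x = of_real (\<Phi> l x)"
  by (simp add: laguerre_harmonic_def \<Phi>_def laguerre_fun_def \<nu>_def s_def)

text \<open>\<open>\<Phi> l\<close> is a polynomial in \<open>norm x powr a\<close> times
  \<open>exp (- s x)\<close>, and rapid decrease survives each further factor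
  \<open>norm x powr a\<close>.\<close>

lemma Phi_rapidly_decreasing: "rapidly_decreasing (\<Phi> l)"
proof -
  define c where "c = (\<lambda>k. (- 1) ^ k * ((\<nu> + real l) gchoose (l - k)) * (2 / a) ^ k / fact k)"
  have \<Phi>_eq: "\<Phi> l x = (\<Sum>k\<le>l. c k * ((norm x powr a) ^ k * exp (- (1 * s x))))" for x
    by (simp add: \<Phi>_def laguerre_fun_def laguerre_def c_def s_def sum_distrib_right sum_distrib_left
        power_mult_distrib power_divide mult_ac)
  have term_rd: "rapidly_decreasing (\<lambda>x::'a. (norm x powr a) ^ k * exp (- (1 * s x)))" for k
  proof (induction k)
    case 0
    then show ?case using rapidly_decreasing_exp_s[of 1] by simp
  next
    case (Suc k)
    from rapidly_decreasing_powr[OF this, of a] show ?case using a_pos by (simp add: mult_ac)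
  qed
  have 0: "rapidly_decreasing (\<lambda>x::'a. 0::real)" by (auto simp: rapidly_decreasing_def)
  have "rapidly_decreasing (\<lambda>x::'a. \<Sum>k\<in>A. c k * ((norm x powr a) ^ k * exp (- (1 * s x))))"
    if "finite A" for A
    using that
  proof induction
    case (insert k A)
    have "rapidly_decreasing (\<lambda>x::'a. c k * ((norm x powr a) ^ k * exp (- (1 * s x))))"
      using term_rd by (rule rapidly_decreasing_mult_bounded(2)[of _ _ "\<bar>c k\<bar>"]) auto
    then show ?case using insert rapidly_decreasing_add by simp
  qed (simp add: 0)
  then have "rapidly_decreasing (\<lambda>x. \<Phi> l x)" unfolding \<Phi>_eq by simp
  then show ?thesis by simp
qed

section \<open>Coefficients against the radial eigenfunctions\<close>

lemma rapidly_decreasing_in_L2: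
  fixes f :: "'a \<Rightarrow> complex"
  assumes [measurable]: "f \<in> borel_measurable borel" and f: "rapidly_decreasing f"
  shows "f \<in> L2 \<mu>"
proof -
  obtain B where B: "\<And>x. norm (f x) \<le> B" using rapidly_decreasing_imp_bounded[OF f] by blast
  have "rapidly_decreasing (\<lambda>x. (cmod (f x))\<^sup>2)"
  proof (rule rapidly_decreasing_bounded_mult[OF f])
    fix x show "norm ((cmod (f x))\<^sup>2) \<le> B * norm (f x)"
      using mult_right_mono[OF B[of x], of "norm (f x)"] by (simp add: power2_eq_square)
  qed
  then have "integrable \<mu> (\<lambda>x. (cmod (f x))\<^sup>2)" by (intro integrable_gen) measurable
  then show ?thesis by (simp add: L2_def)
qed

text \<open>As \<open>\<Phi> l\<close> is real, this is the unnormalised inner product of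
  \<open>f\<close> with it.\<close>

definition radial_coeff :: "('a \<Rightarrow> complex) \<Rightarrow> nat \<Rightarrow> complex" where
  "radial_coeff f l = (LINT x|\<mu>. f x * of_real (\<Phi> l x))"

text \<open>The generating function of the \<open>\<Phi> l\<close> is integrated term by term
  against \<open>f\<close>. Their uniform bound \<open>C / \<rho> ^ l\<close> with
  \<open>\<bar>r\<bar> < \<rho>\<close> dominates the terms by a geometric series times
  \<open>norm (f x)\<close>.\<close>

lemma radial_coeff_generating_function:
  fixes f :: "'a \<Rightarrow> complex"
  assumes [measurable]: "f \<in> borel_measurable borel" and f: "rapidly_decreasing f" and r: "\<bar>r\<bar> < 1"
  shows "(\<lambda>l. radial_coeff f l * of_real (r ^ l)) sums
     (of_real ((1 - r) powr (- (\<nu> + 1))) * (LINT x|\<mu>. f x * of_real (exp (- ((1 + r) / (1 - r) * s x)))))"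
proof -
  \<comment> \<open>The midpoint between \<open>\<bar>r\<bar>\<close> and 1 leaves room for a ratio
    \<open>\<bar>r\<bar> / \<rho>\<close> below 1.\<close>
  define \<rho> where "\<rho> = (1 + \<bar>r\<bar>) / 2"
  have \<rho>: "0 < \<rho>" "\<rho> < 1" "\<bar>r\<bar> < \<rho>" using r by (auto simp: \<rho>_def)
  define C where "C = (1 - \<rho>) powr (- (\<nu> + 1))"
  have C: "\<bar>\<Phi> l x\<bar> \<le> C / \<rho> ^ l" for l x
    unfolding C_def using \<rho> by (intro Phi_bound)
  define q where "q = \<bar>r\<bar> / \<rho>"
  have q: "0 \<le> q" "q < 1" using \<rho> by (auto simp: q_def)
  define T where "T = (\<lambda>l x. f x * of_real (\<Phi> l x) * of_real (r ^ l))"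
  have [measurable]: "T l \<in> borel_measurable borel" for l unfolding T_def by measurable
  have T_le: "norm (T l x) \<le> C * q ^ l * norm (f x)" for l x
  proof -
    have "norm (T l x) = norm (f x) * (\<bar>\<Phi> l x\<bar> * \<bar>r\<bar> ^ l)"
      by (simp add: T_def norm_mult norm_power)
    also have "\<dots> \<le> norm (f x) * (C / \<rho> ^ l * \<bar>r\<bar> ^ l)"
      by (intro mult_left_mono mult_right_mono C) auto
    finally show ?thesis by (simp add: q_def power_divide mult_ac)
  qed
  have int_f: "integrable \<mu> (\<lambda>x. norm (f x))"
    using f by (intro integrable_norm integrable_gen) auto
  have int_T: "integrable \<mu> (T l)" for l
    by (intro integrable_gen rapidly_decreasing_bounded_mult[OF f T_le]) measurable
  have geo: "summable (\<lambda>l. C * q ^ l * D)" for D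
    using q by (intro summable_mult summable_mult2 summable_geometric) auto
  have "(\<lambda>l. LINT x|\<mu>. T l x) sums (LINT x|\<mu>. (\<Sum>l. T l x))"
  proof (rule sums_integral)
    show "AE x in \<mu>. summable (\<lambda>l. norm (T l x))"
      using T_le by (intro AE_I2 summable_comparison_test'[OF geo]) auto
    show "summable (\<lambda>l. LINT x|\<mu>. norm (T l x))"
    proof (rule summable_comparison_test'[OF geo])
      fix l
      have "(LINT x|\<mu>. norm (T l x)) \<le> (LINT x|\<mu>. C * q ^ l * norm (f x))"
        by (intro integral_mono integrable_norm int_T integrable_mult_right int_f T_le)
      then show "norm (LINT x|\<mu>. norm (T l x)) \<le> C * q ^ l * (LINT x|\<mu>. norm (f x))"
        by simp
    qed
  qed (rule int_T)
  moreover have "(\<Sum>l. T l x) = of_real ((1 - r) powr (- (\<nu> + 1))) * (f x * of_real (exp (- ((1 + r) / (1 - r) * s x))))" for x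
  proof -
    have "(\<lambda>l. complex_of_real (\<Phi> l x * r ^ l)) sums
        of_real ((1 - r) powr (- (\<nu> + 1)) * exp (- (s x * (1 + r) / (1 - r))))"
      unfolding sums_of_real_iff \<Phi>_def by (rule laguerre_fun_generating_function_real[OF nu_gt r])
    from sums_mult[OF this, of "f x"] show ?thesis
      by (intro sums_unique[symmetric]) (simp add: T_def mult_ac)
  qed
  moreover have "(LINT x|\<mu>. T l x) = radial_coeff f l * of_real (r ^ l)" for l
    unfolding T_def radial_coeff_def by (rule integral_mult_left_zero)
  ultimately show ?thesis by simp
qed

text \<open>Unitarity preserves the inner product of \<open>f\<close> with the eigenfunction
  \<open>\<Phi> l\<close>, whose eigenvalue \<open>exp (- \<i> * pi * l)\<close> is the sign
  \<open>(- 1) ^ l\<close>.\<close>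

lemma radial_coeff_gen_fourier_transform:
  assumes F: "gen_fourier_transform \<Omega> \<kappa> a F"
    and f_meas [measurable]: "f \<in> borel_measurable borel" and f: "rapidly_decreasing f"
    and g_meas [measurable]: "g \<in> borel_measurable borel"
    and Ff: "AE x in \<mu>. F f x = g x"
  shows "radial_coeff g l = (- 1) ^ l * radial_coeff f l"
proof -
  define P where "P = laguerre_harmonic \<Omega> \<kappa> a l 0 (\<lambda>_. 1)"
  have P_eq: "P = (\<lambda>x. of_real (\<Phi> l x))" unfolding P_def by (simp add: laguerre_harmonic_radial fun_eq_iff)
  have P_meas [measurable]: "P \<in> borel_measurable borel" unfolding P_eq by measurable
  have "rapidly_decreasing P"
    unfolding P_eq using Phi_rapidly_decreasing[of l] by (simp add: rapidly_decreasing_def)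
  then have P: "P \<in> L2 \<mu>" by (rule rapidly_decreasing_in_L2[OF P_meas])
  have f_L2: "f \<in> L2 \<mu>" using f by (rule rapidly_decreasing_in_L2[OF f_meas])
  have U: "unitary_L2 \<mu> F" using F by (simp add: gen_fourier_transform_def)
  have "exp (- (\<i> * of_real (pi * (real l + real 0 / a)))) = (- 1 :: complex) ^ l"
  proof -
    have "exp (- (\<i> * of_real (pi * (real l + real 0 / a)))) = exp (of_nat l * - (of_real pi * \<i>))"
      by (simp add: mult_ac)
    also have "\<dots> = exp (- (of_real pi * \<i>)) ^ l" by (rule exp_of_nat_mult)
    finally show ?thesis by (simp add: exp_minus)
  qed
  then have FP: "AE x in \<mu>. F P x = (- 1) ^ l * P x"
    using F dunkl_harmonic_const[of \<Omega> \<kappa> 1] unfolding gen_fourier_transform_def P_def by metis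
  have "borel_measurable \<mu> = (borel_measurable borel :: ('a \<Rightarrow> complex) set)"
    by (rule measurable_cong_sets) auto
  then have FfM [measurable]: "F f \<in> borel_measurable borel" and FPM [measurable]: "F P \<in> borel_measurable borel"
    using U f_L2 P by (auto simp: unitary_L2_def L2_def)
  have [measurable]: "cnj \<in> borel_measurable borel"
    by (intro borel_measurable_continuous_onI continuous_intros)
  have "L2_inner \<mu> (F f) (F P) = L2_inner \<mu> f P"
    using U f_L2 P by (simp add: unitary_L2_def)
  moreover have "L2_inner \<mu> f P = radial_coeff f l" by (simp add: L2_inner_def radial_coeff_def P_eq)
  moreover have "L2_inner \<mu> (F f) (F P) = (LINT x|\<mu>. (- 1) ^ l * (g x * of_real (\<Phi> l x)))"
    unfolding L2_inner_def
  proof (rule integral_cong_AE)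
    show "AE x in \<mu>. F f x * cnj (F P x) = (- 1) ^ l * (g x * complex_of_real (\<Phi> l x))"
      using Ff FP by eventually_elim (simp add: P_eq)
  qed measurable
  ultimately have "(- 1) ^ l * radial_coeff g l = radial_coeff f l" by (simp add: radial_coeff_def)
  \<comment> \<open>The sign is its own inverse.\<close>
  then have "(- 1) ^ l * ((- 1) ^ l * radial_coeff g l) = (- 1) ^ l * radial_coeff f l" by simp
  then show ?thesis by (simp add: mult.assoc[symmetric] flip: power_mult_distrib)
qed

text \<open>
  This is the formula \<open>F (exp (- t * s)) = t powr (- (\<nu> + 1)) * exp (- s / t)\<close>, with \<open>t = 1 / u\<close>, in weak form.
\<close>

lemma integral_transform_scaled:
  assumes F: "gen_fourier_transform \<Omega> \<kappa> a F"
    and f_meas [measurable]: "f \<in> borel_measurable borel" and f: "rapidly_decreasing f"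
    and g_meas [measurable]: "g \<in> borel_measurable borel" and g: "rapidly_decreasing g"
    and Ff: "AE x in \<mu>. F f x = g x"
    and u: "0 < u" "u \<le> 1"
  shows "(LINT x|\<mu>. g x * of_real (exp (- (u * s x))))
       = (LINT x|\<mu>. f (u powr (1 / a) *\<^sub>R x) * of_real (exp (- s x)))"
proof -
  \<comment> \<open>The solution of \<open>(1 + r) / (1 - r) = 1 / u\<close>; by the reciprocal
    property, \<open>- r\<close> gives \<open>u\<close>.\<close>
  define r where "r = (1 - u) / (1 + u)"
  have r: "\<bar>r\<bar> < 1" "\<bar>- r\<bar> < 1" using u by (auto simp: r_def field_simps)
  have "1 + r = 2 / (1 + u)" "1 - r = 2 * u / (1 + u)"
    using u by (simp_all add: r_def field_simps)
  then have "(1 + r) * u = 1 - r" by simp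
  then have r1: "(1 + r) / (1 - r) = 1 / u" "(1 + - r) / (1 - - r) = u"
    using u r by (auto simp: field_simps)
  define I where "I = (LINT x|\<mu>. f x * of_real (exp (- (1 / u * s x))))"
  define J where "J = (LINT x|\<mu>. g x * of_real (exp (- (u * s x))))"
  \<comment> \<open>The sign acquired under the transform is absorbed by passing from
    \<open>r\<close> to \<open>- r\<close>, so the generating functions of \<open>g\<close> at
    \<open>- r\<close> and of \<open>f\<close> at \<open>r\<close> coincide.\<close>
  have "radial_coeff g l * of_real ((- r) ^ l) = radial_coeff f l * of_real (r ^ l)" for l
  proof -
    have "(- 1) ^ l * radial_coeff f l * of_real ((- r) ^ l) = ((- 1) * (- 1)) ^ l * (radial_coeff f l * of_real (r ^ l))"
      unfolding power_mult_distrib power_minus[of r] by simp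
    then show ?thesis
      unfolding radial_coeff_gen_fourier_transform[OF F f_meas f g_meas Ff] by simp
  qed
  with radial_coeff_generating_function[OF g_meas g r(2)] radial_coeff_generating_function[OF f_meas f r(1)]
  have "of_real ((1 - - r) powr (- (\<nu> + 1))) * J = of_real ((1 - r) powr (- (\<nu> + 1))) * I"
    unfolding r1 I_def J_def by (metis (no_types, lifting) sums_cong sums_unique2)
  then have "of_real ((1 + r) powr (\<nu> + 1)) * (of_real ((1 + r) powr (- (\<nu> + 1))) * J)
      = of_real ((1 + r) powr (\<nu> + 1)) * (of_real ((1 - r) powr (- (\<nu> + 1))) * I)" by simp
  moreover have "(1 + r) powr (\<nu> + 1) * (1 + r) powr (- (\<nu> + 1)) = 1"
    using r by (simp flip: powr_add)
  moreover have "(1 + r) powr (\<nu> + 1) * (1 - r) powr (- (\<nu> + 1)) = u powr (- (\<nu> + 1))"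
  proof -
    have "(1 + r) powr (\<nu> + 1) * (1 - r) powr (- (\<nu> + 1)) = ((1 + r) / (1 - r)) powr (\<nu> + 1)"
      using r by (simp add: powr_divide powr_minus_divide[of _ "\<nu> + 1"] del: minus_add_distrib)
    also have "\<dots> = u powr (- (\<nu> + 1))"
      unfolding r1 using u by (simp add: powr_divide powr_minus_divide[of _ "\<nu> + 1"] del: minus_add_distrib)
    finally show ?thesis .
  qed
  ultimately have J: "J = of_real (u powr (- (\<nu> + 1))) * I"
    by (metis (no_types, lifting) mult.assoc mult_1 of_real_1 of_real_mult)
  \<comment> \<open>Dilation by \<open>c\<close> turns \<open>s / u\<close> into \<open>s\<close>,
    and its factor \<open>u powr (\<nu> + 1)\<close> cancels the one in front of
    \<open>I\<close>.\<close>
  define c where "c = u powr (1 / a)"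
  have c: "c > 0" "c powr a = u" using u a_pos by (simp_all add: c_def powr_powr)
  have "I = c powr (a * (\<nu> + 1)) *\<^sub>R (LINT x|\<mu>. f (c *\<^sub>R x) * of_real (exp (- (1 / u * s (c *\<^sub>R x)))))"
    unfolding I_def using c by (subst integral_gen_scaleR[of c]) auto
  moreover have "1 / u * s (c *\<^sub>R x) = s x" for x using c u by (simp add: s_scaleR)
  moreover have "c powr (a * (\<nu> + 1)) = u powr (\<nu> + 1)" using c by (simp flip: powr_powr)
  ultimately have "I = of_real (u powr (\<nu> + 1)) * (LINT x|\<mu>. f (c *\<^sub>R x) * of_real (exp (- s x)))"
    by (simp add: scaleR_conv_of_real)
  then have "J = of_real (u powr (- (\<nu> + 1)) * u powr (\<nu> + 1)) * (LINT x|\<mu>. f (c *\<^sub>R x) * of_real (exp (- s x)))"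
    unfolding J by simp
  also have "u powr (- (\<nu> + 1)) * u powr (\<nu> + 1) = 1" using u by (simp flip: powr_add)
  finally show ?thesis by (simp add: J_def c_def)
qed

end

section \<open>Comparison of the asymptotics\<close>

lemma bounded_by_vanishing_imp_nonpos:
  fixes K C D p q :: real
  assumes "p > 0" "q > 0" and le: "\<And>u. 0 < u \<Longrightarrow> u \<le> 1 \<Longrightarrow> K \<le> C * u powr p + D * u powr q"
  shows "K \<le> 0"
proof (rule tendsto_lowerbound)
  have "((\<lambda>u::real. u powr t) \<longlongrightarrow> 0) (at_right 0)" if "t > 0" for t
    using that by (intro tendsto_zero_powrI[where b = t]) (auto simp: eventually_at_right_less intro!: eventually_at_rightI[of 0 1])
  then have "((\<lambda>u. C * u powr p + D * u powr q) \<longlongrightarrow> C * 0 + D * 0) (at_right 0)"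
    using assms(1,2) by (intro tendsto_intros) auto
  then show "((\<lambda>u. C * u powr p + D * u powr q) \<longlongrightarrow> 0) (at_right 0)" by simp
  have "\<forall>\<^sub>F u in at_right (0::real). u \<in> {0<..<1}"
    by (rule eventually_at_right_real) simp
  then show "\<forall>\<^sub>F u in at_right 0. K \<le> C * u powr p + D * u powr q"
    by eventually_elim (auto intro: le)
qed simp

text \<open>Division by \<open>u powr p\<close> leaves a positive constant below a quantity that
  tends to 0 with \<open>u\<close>.\<close>

lemma no_faster_decay:
  fixes c C p q :: real
  assumes "c > 0" "p < q" "\<And>u. 0 < u \<Longrightarrow> u \<le> 1 \<Longrightarrow> c * u powr p \<le> C * u powr q"
  shows False
proof -
  have "c \<le> 0"
  proof (rule bounded_by_vanishing_imp_nonpos[of "q - p" "q - p"])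
    fix u :: real assume u: "0 < u" "u \<le> 1"
    show "c \<le> C * u powr (q - p) + 0 * u powr (q - p)"
      using assms(3)[OF u] u by (simp add: powr_diff field_simps)
  qed (use assms in auto)
  then show False using assms(1) by simp
qed

text \<open>Both follow from \<open>1 + t \<le> exp t\<close>, at \<open>t = y\<close> and at
  \<open>t = - y\<close>.\<close>

lemma exp_minus_bounds:
  fixes y :: real
  assumes "y \<ge> 0"
  shows "y * exp (- y) \<le> 1 - exp (- y)" "1 - exp (- y) \<le> y"
proof -
  have "(1 + y) * exp (- y) \<le> exp y * exp (- y)"
    by (intro mult_right_mono exp_ge_add_one_self) auto
  then show "y * exp (- y) \<le> 1 - exp (- y)" by (simp add: algebra_simps flip: exp_add)
  show "1 - exp (- y) \<le> y" using exp_ge_add_one_self[of "- y"] by simp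
qed

section \<open>The two defects and their orders of decay\<close>

context dunkl_setting
begin

text \<open>The distance of the left side of \<open>integral_transform_scaled\<close> from its
  limit, the integral of \<open>g\<close>, as \<open>u\<close> tends to 0.\<close>

definition laplace_defect :: "('a \<Rightarrow> complex) \<Rightarrow> real \<Rightarrow> complex" where
  "laplace_defect g u = (LINT x|\<mu>. g x * of_real (1 - exp (- (u * s x))))"

text \<open>The same for the right side, whose limit is \<open>f 0\<close> times the integral of
  \<open>exp (- s x)\<close>.\<close>

definition dilation_defect :: "('a \<Rightarrow> complex) \<Rightarrow> real \<Rightarrow> complex" where
  "dilation_defect f u = (LINT x|\<mu>. (f 0 - f (u powr (1 / a) *\<^sub>R x)) * of_real (exp (- s x)))"

lemma rapidly_decreasing_s_mult:
  fixes h :: "'a \<Rightarrow> 'b::real_normed_vector"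
  assumes "rapidly_decreasing h"
  shows "rapidly_decreasing (\<lambda>x. s x *\<^sub>R h x)"
proof (rule rapidly_decreasing_bounded_mult[OF rapidly_decreasing_powr[OF assms, of a]])
  show "norm (s x *\<^sub>R h x) \<le> (1 / a) * norm (norm x powr a *\<^sub>R h x)" for x
    using a_pos by (simp add: s_def)
qed (use a_pos in simp)

text \<open>From \<open>1 - exp (- (u * s x)) \<le> u * s x\<close>, where
  \<open>s x *\<^sub>R g x\<close> is still integrable.\<close>

lemma laplace_defect_bound:
  fixes g :: "'a \<Rightarrow> complex"
  assumes [measurable]: "g \<in> borel_measurable borel" and g: "rapidly_decreasing g"
  obtains C where "\<And>u. 0 < u \<Longrightarrow> norm (laplace_defect g u) \<le> C * u"
proof
  fix u :: real assume u: "u > 0"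
  have "norm (laplace_defect g u) \<le> (LINT x|\<mu>. u * norm (s x *\<^sub>R g x))"
    unfolding laplace_defect_def
  proof (rule Bochner_Integration.integral_norm_bound_integral)
    show i: "integrable \<mu> (\<lambda>x. u * norm (s x *\<^sub>R g x))"
      using g by (intro integrable_mult_right integrable_norm integrable_gen rapidly_decreasing_s_mult) auto
    show le: "norm (g x * of_real (1 - exp (- (u * s x)))) \<le> u * norm (s x *\<^sub>R g x)" for x
    proof -
      have "norm (complex_of_real (1 - exp (- (u * s x)))) \<le> u * s x"
        using exp_minus_bounds[of "u * s x"] u s_nonneg[of x] unfolding norm_of_real by simp
      from mult_left_mono[OF this, of "norm (g x)"] show ?thesis
        using s_nonneg[of x] by (simp add: norm_mult mult_ac del: of_real_diff)
    qed
    show "integrable \<mu> (\<lambda>x. g x * of_real (1 - exp (- (u * s x))))"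
      by (rule Bochner_Integration.integrable_bound[OF i])
        (use le in \<open>auto intro: order_trans[OF _ abs_ge_self]\<close>)
  qed
  then show "norm (laplace_defect g u) \<le> (LINT x|\<mu>. norm (s x *\<^sub>R g x)) * u"
    by (simp add: mult.commute)
qed

lemma integrable_dilated:
  fixes f :: "'a \<Rightarrow> complex"
  assumes [measurable]: "f \<in> borel_measurable borel" and f: "rapidly_decreasing f"
  shows "integrable \<mu> (\<lambda>x. f (c *\<^sub>R x) * of_real (exp (- s x)))"
proof -
  obtain B where "\<And>x. norm (f x) \<le> B" using rapidly_decreasing_imp_bounded[OF f] by blast
  moreover have "rapidly_decreasing (\<lambda>x. complex_of_real (exp (- s x)))"
    using rapidly_decreasing_exp_s[of 1] by (simp add: rapidly_decreasing_def)
  ultimately show ?thesis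
    by (intro integrable_gen rapidly_decreasing_mult_bounded(2)) auto
qed

lemma integrable_exp_s: "integrable \<mu> (\<lambda>x. complex_of_real (exp (- s x)))"
  using integrable_gen[OF _ rapidly_decreasing_exp_s[of 1]] by simp

text \<open>Since \<open>\<mu>\<close> is even, the integrand may be averaged with its reflection at
  the origin, which brings in the second difference of \<open>f\<close> at scale
  \<open>c = u powr (1 / a)\<close>, of order \<open>c\<^sup>2\<close>.\<close>

lemma dilation_defect_bound:
  assumes f: "f \<in> schwartz"
  obtains C where "\<And>u. 0 < u \<Longrightarrow> norm (dilation_defect f u) \<le> C * u powr (2 / a)"
proof -
  note f_meas [measurable] = schwartz_borel_measurable[OF f]
  note rd = schwartz_rapidly_decreasing[OF f]
  obtain C where C: "\<And>x. norm (f x + f (- x) - 2 * f 0) \<le> C * (norm x)\<^sup>2"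
    using schwartz_second_difference[OF f] by blast
  define N where "N = (LINT x|\<mu>. norm x ^ 2 *\<^sub>R exp (- (1 * s x)))"
  have int2: "integrable \<mu> (\<lambda>x. norm x ^ 2 *\<^sub>R exp (- (1 * s x)))"
    by (intro integrable_gen rapidly_decreasing_power rapidly_decreasing_exp_s) auto
  have "norm (dilation_defect f u) \<le> C * N / 2 * u powr (2 / a)" if u: "u > 0" for u
  proof -
    define c where "c = u powr (1 / a)"
    have c2: "c\<^sup>2 = u powr (2 / a)" using u by (simp add: c_def powr_power)
    define e where "e = (\<lambda>x. complex_of_real (exp (- s x)))"
    have s_minus: "s (- x) = s x" for x by (simp add: s_def)
    have int: "integrable \<mu> (\<lambda>x. (f 0 - f (c *\<^sub>R x)) * e x)" "integrable \<mu> (\<lambda>x. (f 0 - f (- (c *\<^sub>R x))) * e x)"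
      using integrable_dilated[OF f_meas rd, of c] integrable_dilated[OF f_meas rd, of "- c"] integrable_exp_s
      by (auto simp: e_def left_diff_distrib)
    have "dilation_defect f u = (LINT x|\<mu>. (f 0 - f (c *\<^sub>R x)) * e x)" by (simp add: dilation_defect_def c_def e_def)
    \<comment> \<open>Scaling by \<open>-1\<close> leaves \<open>\<mu>\<close> and \<open>s\<close>
      invariant.\<close>
    moreover have "(LINT x|\<mu>. (f 0 - f (c *\<^sub>R x)) * e x) = (LINT x|\<mu>. (f 0 - f (- (c *\<^sub>R x))) * e x)"
      using integral_gen_scaleR[of "-1" "\<lambda>x. (f 0 - f (c *\<^sub>R x)) * e x"]
      by (simp add: e_def s_minus)
    ultimately have "2 * dilation_defect f u
        = (LINT x|\<mu>. (f 0 - f (c *\<^sub>R x)) * e x) + (LINT x|\<mu>. (f 0 - f (- (c *\<^sub>R x))) * e x)"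
      by simp
    also have "\<dots> = (LINT x|\<mu>. (f 0 - f (c *\<^sub>R x)) * e x + (f 0 - f (- (c *\<^sub>R x))) * e x)"
      using int by simp
    also have "norm \<dots> \<le> (LINT x|\<mu>. (C * c\<^sup>2) * (norm x ^ 2 *\<^sub>R exp (- (1 * s x))))"
    proof (rule Bochner_Integration.integral_norm_bound_integral)
      fix x
      have "norm ((f 0 - f (c *\<^sub>R x)) * e x + (f 0 - f (- (c *\<^sub>R x))) * e x)
          = norm (- (f (c *\<^sub>R x) + f (- (c *\<^sub>R x)) - 2 * f 0) * e x)"
        by (simp add: algebra_simps)
      also have "\<dots> = norm (f (c *\<^sub>R x) + f (- (c *\<^sub>R x)) - 2 * f 0) * exp (- s x)"
        unfolding norm_mult norm_minus_cancel by (simp add: e_def)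
      also have "\<dots> \<le> C * (norm (c *\<^sub>R x))\<^sup>2 * exp (- s x)"
        by (intro mult_right_mono C) auto
      finally show "norm ((f 0 - f (c *\<^sub>R x)) * e x + (f 0 - f (- (c *\<^sub>R x))) * e x)
          \<le> (C * c\<^sup>2) * (norm x ^ 2 *\<^sub>R exp (- (1 * s x)))"
        by (simp add: power_mult_distrib mult_ac)
    qed (use int int2 in auto)
    also have "\<dots> = C * c\<^sup>2 * N" by (simp add: N_def)
    finally show ?thesis by (simp add: norm_mult c2 mult_ac)
  qed
  then show ?thesis using that by blast
qed

text \<open>The integrals behind the defects agree, so the defects differ by the constant difference
  \<open>K\<close> of the two limits. Both defects tend to 0 with \<open>u\<close>, hence
  \<open>K = 0\<close>.\<close>

lemma laplace_defect_eq_dilation_defect: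
  assumes F: "gen_fourier_transform \<Omega> \<kappa> a F"
    and f: "f \<in> schwartz" and g: "g \<in> schwartz"
    and Ff: "AE x in \<mu>. F f x = g x"
    and u: "0 < u" "u \<le> 1"
  shows "laplace_defect g u = dilation_defect f u"
proof -
  note f_meas [measurable] = schwartz_borel_measurable[OF f]
  note g_meas [measurable] = schwartz_borel_measurable[OF g]
  note f_rd = schwartz_rapidly_decreasing[OF f]
  note g_rd = schwartz_rapidly_decreasing[OF g]
  define K where "K = (LINT x|\<mu>. g x) - f 0 * (LINT x|\<mu>. complex_of_real (exp (- s x)))"
  have K: "laplace_defect g v - dilation_defect f v = K" if v: "0 < v" "v \<le> 1" for v
  proof -
    have g_exp: "integrable \<mu> (\<lambda>x. g x * of_real (exp (- (v * s x))))"
      using v s_nonneg by (intro integrable_gen rapidly_decreasing_mult_bounded(1)[OF g_rd, of _ 1]) auto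
    have "laplace_defect g v = (LINT x|\<mu>. g x - g x * of_real (exp (- (v * s x))))"
      by (simp add: laplace_defect_def right_diff_distrib)
    also have "\<dots> = (LINT x|\<mu>. g x) - (LINT x|\<mu>. g x * of_real (exp (- (v * s x))))"
      by (rule Bochner_Integration.integral_diff[OF integrable_gen[OF g_meas g_rd] g_exp])
    finally have 1: "laplace_defect g v = \<dots>" .
    have "dilation_defect f v = (LINT x|\<mu>. f 0 * of_real (exp (- s x)) - f (v powr (1 / a) *\<^sub>R x) * of_real (exp (- s x)))"
      by (simp add: dilation_defect_def left_diff_distrib)
    also have "\<dots> = (LINT x|\<mu>. f 0 * of_real (exp (- s x)))
        - (LINT x|\<mu>. f (v powr (1 / a) *\<^sub>R x) * of_real (exp (- s x)))"
      using integrable_exp_s integrable_dilated[OF f_meas f_rd]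
      by (intro Bochner_Integration.integral_diff integrable_mult_right) auto
    finally have 2: "dilation_defect f v = \<dots>" .
    show ?thesis
      unfolding 1 2 K_def integral_transform_scaled[OF F f_meas f_rd g_meas g_rd Ff v] by simp
  qed
  obtain A where A: "\<And>u. 0 < u \<Longrightarrow> norm (laplace_defect g u) \<le> A * u"
    using laplace_defect_bound[OF g_meas g_rd] by blast
  obtain B where B: "\<And>u. 0 < u \<Longrightarrow> norm (dilation_defect f u) \<le> B * u powr (2 / a)"
    using dilation_defect_bound[OF f] by blast
  have "norm K \<le> 0"
  proof (rule bounded_by_vanishing_imp_nonpos[of 1 "2 / a"])
    fix v :: real assume v: "0 < v" "v \<le> 1"
    have "norm K \<le> norm (laplace_defect g v) + norm (dilation_defect f v)"
      unfolding K[OF v, symmetric] by (rule norm_triangle_ineq4)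
    then show "norm K \<le> A * v powr 1 + B * v powr (2 / a)"
      using A[of v] B[of v] v by simp
  qed (use a_pos in auto)
  then show ?thesis using K[OF u] by simp
qed

section \<open>Sharpness of the orders for the Gaussian\<close>

abbreviation gaussian :: "'a \<Rightarrow> complex" where
  "gaussian x \<equiv> of_real (exp (- (x \<bullet> x)))"

lemma gaussian_laplace_defect_lower:
  obtains c where "c > 0" "\<And>u. 0 < u \<Longrightarrow> u \<le> 1 \<Longrightarrow> c * u \<le> norm (laplace_defect gaussian u)"
proof
  \<comment> \<open>By \<open>y * exp (- y) \<le> 1 - exp (- y)\<close> with
    \<open>y = u * s x\<close>, and by \<open>exp (- s x) \<le> exp (- y)\<close> for
    \<open>u \<le> 1\<close>, the integrand of the defect is at least \<open>u * h x\<close>, with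
    \<open>h\<close> independent of \<open>u\<close>.\<close>
  define h where "h = (\<lambda>x::'a. s x *\<^sub>R (exp (- (x \<bullet> x)) * exp (- s x)))"
  have h_rd: "rapidly_decreasing h"
    unfolding h_def using s_nonneg
    by (intro rapidly_decreasing_s_mult rapidly_decreasing_mult_bounded(1)[OF rapidly_decreasing_gaussian, of _ 1]) auto
  have h_meas [measurable]: "h \<in> borel_measurable borel" unfolding h_def by measurable
  show "(LINT x|\<mu>. h x) > 0"
    using s_pos s_nonneg by (intro integral_gen_pos h_rd) (auto simp: h_def)
  fix u :: real assume u: "0 < u" "u \<le> 1"
  have "(LINT x|\<mu>. h x) * u = (LINT x|\<mu>. u * h x)" by simp
  also have "\<dots> \<le> (LINT x|\<mu>. exp (- (x \<bullet> x)) * (1 - exp (- (u * s x))))"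
  proof (rule integral_mono)
    show "integrable \<mu> (\<lambda>x. u * h x)" by (intro integrable_mult_right integrable_gen h_rd) auto
    show "integrable \<mu> (\<lambda>x. exp (- (x \<bullet> x)) * (1 - exp (- (u * s x))))"
      using s_nonneg u
      by (intro integrable_gen rapidly_decreasing_mult_bounded(1)[OF rapidly_decreasing_gaussian, of _ 1]) auto
    fix x
    have "u * s x * exp (- s x) \<le> u * s x * exp (- (u * s x))"
      using u s_nonneg[of x] by (intro mult_left_mono) (auto simp: mult_left_le_one_le)
    also have "\<dots> \<le> 1 - exp (- (u * s x))" using exp_minus_bounds(1)[of "u * s x"] u s_nonneg[of x] by simp
    finally have "exp (- (x \<bullet> x)) * (u * s x * exp (- s x)) \<le> exp (- (x \<bullet> x)) * (1 - exp (- (u * s x)))"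
      by (intro mult_left_mono) auto
    then show "u * h x \<le> exp (- (x \<bullet> x)) * (1 - exp (- (u * s x)))" by (simp add: h_def mult_ac)
  qed
  also have "\<dots> \<le> norm (complex_of_real (LINT x|\<mu>. exp (- (x \<bullet> x)) * (1 - exp (- (u * s x)))))" by simp
  also have "complex_of_real (LINT x|\<mu>. exp (- (x \<bullet> x)) * (1 - exp (- (u * s x)))) = laplace_defect gaussian u"
    unfolding laplace_defect_def by (simp only: integral_complex_of_real[symmetric] of_real_mult)
  finally show "(LINT x|\<mu>. h x) * u \<le> norm (laplace_defect gaussian u)" .
qed

lemma gaussian_dilation_defect_lower:
  obtains c where "c > 0" "\<And>u. 0 < u \<Longrightarrow> u \<le> 1 \<Longrightarrow> c * u powr (2 / a) \<le> norm (dilation_defect gaussian u)"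
proof
  \<comment> \<open>Same device with \<open>y = c\<^sup>2 * (x \<bullet> x)\<close>: as
    \<open>c\<^sup>2 \<le> 1\<close>, the integrand of the defect is at least
    \<open>c\<^sup>2 * h x\<close>.\<close>
  define h where "h = (\<lambda>x::'a. norm x ^ 2 *\<^sub>R (exp (- (x \<bullet> x)) * exp (- s x)))"
  have h_rd: "rapidly_decreasing h"
    unfolding h_def using s_nonneg
    by (intro rapidly_decreasing_power rapidly_decreasing_mult_bounded(1)[OF rapidly_decreasing_gaussian, of _ 1]) auto
  have h_meas [measurable]: "h \<in> borel_measurable borel" unfolding h_def by measurable
  show "(LINT x|\<mu>. h x) > 0"
    by (intro integral_gen_pos h_rd) (auto simp: h_def)
  fix u :: real assume u: "0 < u" "u \<le> 1"
  define c where "c = u powr (1 / a)"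
  have c2: "c\<^sup>2 = u powr (2 / a)" using u by (simp add: c_def powr_power)
  have c: "0 \<le> c\<^sup>2" "c\<^sup>2 \<le> 1" using u a_pos by (auto simp: c2 powr_le1)
  have "(LINT x|\<mu>. h x) * u powr (2 / a) = (LINT x|\<mu>. c\<^sup>2 * h x)" by (simp add: c2)
  also have "\<dots> \<le> (LINT x|\<mu>. (1 - exp (- (c\<^sup>2 * (x \<bullet> x)))) * exp (- s x))"
  proof (rule integral_mono)
    show "integrable \<mu> (\<lambda>x. c\<^sup>2 * h x)" by (intro integrable_mult_right integrable_gen h_rd) auto
    have "rapidly_decreasing (\<lambda>x. exp (- s x))" using rapidly_decreasing_exp_s[of 1] by simp
    then show "integrable \<mu> (\<lambda>x. (1 - exp (- (c\<^sup>2 * (x \<bullet> x)))) * exp (- s x))"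
      by (intro integrable_gen rapidly_decreasing_mult_bounded(2)[of _ _ 1]) auto
    fix x :: 'a
    define t where "t = x \<bullet> x"
    have t: "t \<ge> 0" by (simp add: t_def)
    have "c\<^sup>2 * t * exp (- t) \<le> c\<^sup>2 * t * exp (- (c\<^sup>2 * t))"
      using c t by (intro mult_left_mono) (auto simp: mult_left_le_one_le)
    also have "\<dots> \<le> 1 - exp (- (c\<^sup>2 * t))" using exp_minus_bounds(1)[of "c\<^sup>2 * t"] c t by simp
    finally have "c\<^sup>2 * t * exp (- t) * exp (- s x) \<le> (1 - exp (- (c\<^sup>2 * t))) * exp (- s x)"
      by (intro mult_right_mono) auto
    then show "c\<^sup>2 * h x \<le> (1 - exp (- (c\<^sup>2 * (x \<bullet> x)))) * exp (- s x)"
      by (simp add: h_def t_def power2_norm_eq_inner mult_ac)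
  qed
  also have "\<dots> \<le> norm (complex_of_real (LINT x|\<mu>. (1 - exp (- (c\<^sup>2 * (x \<bullet> x)))) * exp (- s x)))" by simp
  also have "complex_of_real (LINT x|\<mu>. (1 - exp (- (c\<^sup>2 * (x \<bullet> x)))) * exp (- s x)) = dilation_defect gaussian u"
    unfolding dilation_defect_def
    by (simp add: integral_complex_of_real[symmetric] c_def[symmetric] power2_eq_square mult.assoc
        del: integral_complex_of_real)
  finally show "(LINT x|\<mu>. h x) * u powr (2 / a) \<le> norm (dilation_defect gaussian u)" .
qed

text \<open>Each inclusion excludes one side: that transforms of Schwartz functions are Schwartz
  excludes \<open>a > 2\<close>, and that every Schwartz function is such a transform excludes
  \<open>a < 2\<close>.\<close>

lemma gen_fourier_transform_schwartz_imp:
  assumes F: "gen_fourier_transform \<Omega> \<kappa> a F"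
    and eq: "(\<lambda>f. L2_class \<mu> (F f)) ` schwartz = L2_class \<mu> ` schwartz"
  shows "a = 2"
proof (rule ccontr)
  assume "a \<noteq> 2"
  have L2: "f \<in> L2 \<mu>" if "f \<in> schwartz" for f
    using that by (intro rapidly_decreasing_in_L2 schwartz_borel_measurable schwartz_rapidly_decreasing)
  from \<open>a \<noteq> 2\<close> consider "a > 2" | "a < 2" by linarith
  then show False
  proof cases
    case 1
    have "L2_class \<mu> (F gaussian) \<in> L2_class \<mu> ` schwartz"
      using eq gaussian_schwartz by blast
    then obtain g where g: "g \<in> schwartz" "L2_class \<mu> (F gaussian) = L2_class \<mu> g" by auto
    have "F gaussian \<in> L2 \<mu>"
      using F L2[OF gaussian_schwartz] by (auto simp: gen_fourier_transform_def unitary_L2_def)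
    \<comment> \<open>Membership in its own class, which relies on square integrability, turns the
      equality of classes into equality almost everywhere.\<close>
    then have "F gaussian \<in> L2_class \<mu> (F gaussian)" by (simp add: L2_class_def)
    then have ae: "AE x in \<mu>. F gaussian x = g x" unfolding g(2) by (simp add: L2_class_def)
    obtain C where C: "\<And>u. 0 < u \<Longrightarrow> norm (laplace_defect g u) \<le> C * u"
      using laplace_defect_bound[OF schwartz_borel_measurable schwartz_rapidly_decreasing] g(1) by blast
    obtain c where c: "c > 0" "\<And>u. 0 < u \<Longrightarrow> u \<le> 1 \<Longrightarrow> c * u powr (2 / a) \<le> norm (dilation_defect gaussian u)"
      using gaussian_dilation_defect_lower by blast
    show False
    \<comment> \<open>The equal defects would be at least of order \<open>u powr (2 / a)\<close> and
      at most of the smaller order \<open>u\<close>.\<close>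
    proof (rule no_faster_decay[OF c(1), of "2 / a" 1 C])
      show "2 / a < 1" using 1 by simp
      fix u :: real assume u: "0 < u" "u \<le> 1"
      show "c * u powr (2 / a) \<le> C * u powr 1"
        using c(2)[OF u] C[OF u(1)] laplace_defect_eq_dilation_defect[OF F gaussian_schwartz g(1) ae u] u by simp
    qed
  next
    case 2
    have "L2_class \<mu> gaussian \<in> (\<lambda>f. L2_class \<mu> (F f)) ` schwartz"
      using eq gaussian_schwartz by blast
    then obtain f where f: "f \<in> schwartz" "L2_class \<mu> gaussian = L2_class \<mu> (F f)" by auto
    have "gaussian \<in> L2_class \<mu> gaussian"
      using L2[OF gaussian_schwartz] by (simp add: L2_class_def)
    then have "AE x in \<mu>. gaussian x = F f x" unfolding f(2) by (simp add: L2_class_def)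
    then have ae: "AE x in \<mu>. F f x = gaussian x" by (simp add: eq_commute)
    obtain C where C: "\<And>u. 0 < u \<Longrightarrow> norm (dilation_defect f u) \<le> C * u powr (2 / a)"
      using dilation_defect_bound[OF f(1)] by blast
    obtain c where c: "c > 0" "\<And>u. 0 < u \<Longrightarrow> u \<le> 1 \<Longrightarrow> c * u \<le> norm (laplace_defect gaussian u)"
      using gaussian_laplace_defect_lower by blast
    show False
    \<comment> \<open>The roles are reversed: at least of order \<open>u\<close>, yet at most of the
      smaller order \<open>u powr (2 / a)\<close>.\<close>
    proof (rule no_faster_decay[OF c(1), of 1 "2 / a" C])
      show "1 < 2 / a" using 2 a_pos by simp
      fix u :: real assume u: "0 < u" "u \<le> 1"
      show "c * u powr 1 \<le> C * u powr (2 / a)"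
        using c(2)[OF u] C[OF u(1)] laplace_defect_eq_dilation_defect[OF F f(1) gaussian_schwartz ae u] u by simp
    qed
  qed
qed

end

theorem mainTheorem4:
  fixes \<Omega> :: "'a::euclidean_space set"
    and \<kappa> :: "'a \<Rightarrow> real"
    and a :: real
    and F :: "('a \<Rightarrow> complex) \<Rightarrow> ('a \<Rightarrow> complex)"
  assumes "root_system \<Omega>"
    and "nonneg_multiplicity \<Omega> \<kappa>"
    and "a > 0"
    and "2 * dunkl_lambda \<Omega> \<kappa> + a > 0"
    and "gen_fourier_transform \<Omega> \<kappa> a F"
    and "(\<lambda>f. L2_class (gen_measure \<Omega> \<kappa> a) (F f)) ` schwartz
         = L2_class (gen_measure \<Omega> \<kappa> a) ` schwartz"
  shows "a = 2"
proof -
  interpret dunkl_setting \<Omega> \<kappa> a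
    using assms by unfold_locales
  show ?thesis
    using assms(5,6) by (rule gen_fourier_transform_schwartz_imp)
qed

end
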